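(* Let $H$ be a finite dimensional quasi-Hopf algebra over a field $\mathbf k$, with basis $\{b_i\}$ and dual basis $\{b^i\}\subset\hat H=\mathrm{Hom}_{\mathbf k}(H,\mathbf k)$. The following are equivalent: (i) $H$ is semi-simple. (ii) $H$ has a normalized left (or right) integral. (iii) The left cointegral $\lambda_e:=E(\epsilon)=\sum_i S^2(b_i)S(\beta)\alpha\rightharpoonup b^i\in\mathcal L$ is nonzero. (iv) $H$ has a Haar integral $e$. (v) $H$ is a separable $\mathbf k$-algebra. Moreover, in this case the Haar integral $e$ satisfies $\lambda_e(e)=1$.
   Context: Quasi-Hopf algebras. $\mathbf k$ is a field, algebras are unital. A quasi-bialgebra $(H,\Delta,\epsilon,\phi)$ is a unital $\mathbf k$-algebra $H$ with unital algebra morphisms $\Delta:H\to H\otimes H$, $\epsilon:H\to\mathbf k$ and an invertible $\phi\in H\otimes H\otimes H$ such that $(\mathrm{id}\otimes\Delta)(\Delta(a))\,\phi=\phi\,(\Delta\otimes\mathrm{id})(\Delta(a))$ for all $a\in H$; $(\mathrm{id}\otimes\mathrm{id}\otimes\Delta)(\phi)(\Delta\otimes\mathrm{id}\otimes\mathrm{id})(\phi)=(\mathbf 1\otimes\phi)(\mathrm{id}\otimes\Delta\otimes\mathrm{id})(\phi)(\phi\otimes\mathbf 1)$; $(\epsilon\otimes\mathrm{id})\circ\Delta=\mathrm{id}=(\mathrm{id}\otimes\epsilon)\circ\Delta$; $(\mathrm{id}\otimes\epsilon\otimes\mathrm{id})(\phi)=\mathbf 1\otimes\mathbf 1$. Write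 $\Delta(a)=a_{(1)}\otimes a_{(2)}$, $\Delta^{op}(a)=a_{(2)}\otimes a_{(1)}$, $\phi=X^j\otimes Y^j\otimes Z^j$, $\phi^{-1}=\bar X^j\otimes\bar Y^j\otimes\bar Z^j$ (summation suppressed); for $x=x^1\otimes x^2$ put $x^{21}=x^2\otimes x^1$. $H$ is a quasi-Hopf algebra if there are an algebra anti-morphism $S:H\to H$ and $\alpha,\beta\in H$ with $S(a_{(1)})\alpha a_{(2)}=\epsilon(a)\alpha$, $a_{(1)}\beta S(a_{(2)})=\epsilon(a)\beta$ for all $a$, and $X^j\beta S(Y^j)\alpha Z^j=\mathbf 1=S(\bar X^j)\alpha\bar Y^j\beta S(\bar Z^j)$. Standing conventions: $S$ is invertible and $\epsilon(\alpha)=\epsilon(\beta)=1$. Integrals. $l\in H$ is a left (right) integral if $al=\epsilon(a)l$ (resp. $la=\epsilon(a)l$) for all $a\in H$; it is two-sided if both hold; it is normalized if $\epsilon(l)=1$. A Haar integral is a normalized two-sided integral (unique if it exists). Cointegrals. $(a\rightharpoonup\varphi)(b)=\varphi(ba)$ for $\varphi\in\hat H$, so $\lambda_e(a)=\sum_i b^i(aS^2(b_i)S(\beta)\alpha)$. Let $q_R=q_R^1\otimes q_R^2:=X^i\otimes S^{-1}(\alpha Z^i)Y^i$, $p_R:=\bar X^i\otimes\bar Y^i\beta S(\bar Z^i)$. With $T^i\otimes U^i\otimes V^i\otimes W^i:=(\mathbf 1\otimes\phi^{-1})(\mathrm{id}\otimes\mathrm{id}\otimes\Delta)(\phi)$ let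 $\gamma:=S(U^i)\alpha V^i\otimes S(T^i)\alpha W^i$. Drinfeld's element $f:=(S\otimes S)(\Delta^{op}(\bar X^i))\,\gamma\,\Delta(\bar Y^i\beta S(\bar Z^i))$ is invertible. Put $h:=(S^{-1}\otimes S^{-1})(f^{21})$, $U:=f^{-1}(S\otimes S)(q_R^{21})$, $V:=(S^{-1}\otimes S^{-1})(p_R^{21})h$, $\bar\Delta(a):=V\Delta(a)U$. The projection $E:\hat H\to\hat H$ is $E(\psi)(a)=\sum_i(b^i\otimes\psi)\big(\bar\Delta(S^{-1}(q_R^1)\,a\,S^2(q_R^2b_i)S(\beta))\big)$ and $\mathcal L:=E(\hat H)$ is the (one dimensional) space of left cointegrals. *)

theory Defs
  imports "HOL-Analysis.Cartesian_Space"
begin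

section \<open>Semisimple rings\<close>

definition left_ideal :: "'a::ring_1 set \<Rightarrow> bool" where
  "left_ideal I \<longleftrightarrow> 0 \<in> I \<and> (\<forall>x\<in>I. \<forall>y\<in>I. x + y \<in> I) \<and> (\<forall>a. \<forall>x\<in>I. a * x \<in> I)"

text \<open>A module is semisimple if each of its submodules is a direct summand (Lam, \<^emph>\<open>A First Course in
  Noncommutative Rings\<close>, Definition 2.1); a ring is semisimple if its left regular module is.  For
  an algebra over a field, left ideals are automatically linear subspaces.\<close>

definition semisimple_ring :: "'a::ring_1 itself \<Rightarrow> bool" where
  "semisimple_ring _ \<longleftrightarrow>
    (\<forall>I::'a set. left_ideal I \<longrightarrow>
      (\<exists>J. left_ideal J \<and> I \<inter> J = {0} \<and> (\<forall>x. \<exists>y\<in>I. \<exists>z\<in>J. x = y + z)))"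


section \<open>Finite-dimensional algebras with a basis, and their tensor powers\<close>

text \<open>An algebra over a field is a ring \<open>'a\<close> with a compatible scalar multiplication; the basis is
  indexed by a finite type.  The condition \<open>0 \<noteq> 1\<close> built into the class \<open>ring_1\<close> is
  implied by the existence of a counit.\<close>

locale fin_dim_algebra = vector_space scale
  for scale :: "'k::field \<Rightarrow> 'a::ring_1 \<Rightarrow> 'a" (infixr "\<cdot>" 75) +
  fixes b :: "'i::finite \<Rightarrow> 'a"
  assumes scale_mult_left: "c \<cdot> x * y = c \<cdot> (x * y)"
    and scale_mult_right: "x * c \<cdot> y = c \<cdot> (x * y)"
    and inj_basis: "inj b"
    and independent_basis: "independent (range b)"
    and span_basis: "span (range b) = UNIV"
begin

definition dual_basis :: "'i \<Rightarrow> 'a \<Rightarrow> 'k" where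
  "dual_basis i x = representation (range b) x (b i)"

text \<open>The \<open>n\<close>-fold tensor power of the algebra has the basis
  \<open>b i\<^sub>1 \<otimes> \<dots> \<otimes> b i\<^sub>n\<close>, and a tensor is identified with
  its family of coefficients.  In \<open>liftn s F t\<close> the multilinear map \<open>F\<close>, with values in a
  vector space with scalar multiplication \<open>s\<close>, is extended linearly to tensors; this is the
  Sweedler-type notation \<open>F t\<^sup>1 \<dots> t\<^sup>n\<close> for \<open>t = t\<^sup>1 \<otimes> \<dots> \<otimes> t\<^sup>n\<close> with summation
  suppressed.  The lemmas \<open>liftn_tensn\<close> and \<open>liftn_tensn_self\<close> below establish the universal
  property.\<close>

definition tens2 :: "'a \<Rightarrow> 'a \<Rightarrow> ('k, 'i \<times> 'i) vec" where
  "tens2 x y = (\<chi> p. case p of (i, j) \<Rightarrow> dual_basis i x * dual_basis j y)"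

definition tens3 :: "'a \<Rightarrow> 'a \<Rightarrow> 'a \<Rightarrow> ('k, 'i \<times> 'i \<times> 'i) vec" where
  "tens3 x y z = (\<chi> p. case p of (i, j, k) \<Rightarrow> dual_basis i x * dual_basis j y * dual_basis k z)"

definition tens4 :: "'a \<Rightarrow> 'a \<Rightarrow> 'a \<Rightarrow> 'a \<Rightarrow> ('k, 'i \<times> 'i \<times> 'i \<times> 'i) vec" where
  "tens4 x y z w = (\<chi> p. case p of (i, j, k, l) \<Rightarrow> dual_basis i x * dual_basis j y * dual_basis k z * dual_basis l w)"

definition lift2 :: "('k \<Rightarrow> 'w \<Rightarrow> 'w) \<Rightarrow> ('a \<Rightarrow> 'a \<Rightarrow> 'w::ab_group_add) \<Rightarrow>
    ('k, 'i \<times> 'i) vec \<Rightarrow> 'w" where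
  "lift2 s F t = (\<Sum>i\<in>UNIV. \<Sum>j\<in>UNIV. s (t $ (i, j)) (F (b i) (b j)))"

definition lift3 :: "('k \<Rightarrow> 'w \<Rightarrow> 'w) \<Rightarrow> ('a \<Rightarrow> 'a \<Rightarrow> 'a \<Rightarrow> 'w::ab_group_add) \<Rightarrow>
    ('k, 'i \<times> 'i \<times> 'i) vec \<Rightarrow> 'w" where
  "lift3 s F t = (\<Sum>i\<in>UNIV. \<Sum>j\<in>UNIV. \<Sum>k\<in>UNIV. s (t $ (i, j, k)) (F (b i) (b j) (b k)))"

definition lift4 :: "('k \<Rightarrow> 'w \<Rightarrow> 'w) \<Rightarrow> ('a \<Rightarrow> 'a \<Rightarrow> 'a \<Rightarrow> 'a \<Rightarrow> 'w::ab_group_add) \<Rightarrow>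
    ('k, 'i \<times> 'i \<times> 'i \<times> 'i) vec \<Rightarrow> 'w" where
  "lift4 s F t = (\<Sum>i\<in>UNIV. \<Sum>j\<in>UNIV. \<Sum>k\<in>UNIV. \<Sum>l\<in>UNIV.
     s (t $ (i, j, k, l)) (F (b i) (b j) (b k) (b l)))"

lemma dual_basis_basis: "dual_basis i (b j) = (if i = j then 1 else 0)"
  unfolding dual_basis_def
  by (subst representation_basis[OF independent_basis])
     (auto simp: inj_eq[OF inj_basis])

lemma sum_dual_basis: "(\<Sum>i\<in>UNIV. dual_basis i x \<cdot> b i) = x"
proof -
  have "(\<Sum>v\<in>range b. representation (range b) x v \<cdot> v) = x"
    by (rule sum_representation_eq[OF independent_basis]) (auto simp: span_basis)
  then show ?thesis
    by (simp add: sum.reindex[OF inj_basis] dual_basis_def)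
qed

lemma linear_sum_dual_basis:
  assumes "Vector_Spaces.linear scale s G"
  shows "(\<Sum>i\<in>UNIV. s (dual_basis i x) (G (b i))) = G x"
proof -
  interpret G: Vector_Spaces.linear scale s G by fact
  show ?thesis
    by (subst (2) sum_dual_basis[of x, symmetric]) (simp add: G.sum G.scale)
qed

lemma lift2_tens2:
  assumes "\<And>y. Vector_Spaces.linear scale s (\<lambda>x. F x y)"
    and "\<And>x. Vector_Spaces.linear scale s (F x)"
  shows "lift2 s F (tens2 x y) = F x y"
proof -
  interpret G: Vector_Spaces.linear scale s "F x" by (rule assms)
  have "lift2 s F (tens2 x y) =
      (\<Sum>i\<in>UNIV. s (dual_basis i x) (\<Sum>j\<in>UNIV. s (dual_basis j y) (F (b i) (b j))))"
    by (simp only: lift2_def tens2_def vec_lambda_beta prod.case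
        G.vs2.scale_scale[symmetric] G.vs2.scale_sum_right)
  also have "\<dots> = F x y"
    by (simp only: linear_sum_dual_basis[OF assms(1)] linear_sum_dual_basis[OF assms(2)])
  finally show ?thesis .
qed

lemma lift3_tens3:
  assumes "\<And>y z. Vector_Spaces.linear scale s (\<lambda>x. F x y z)"
    and "\<And>x z. Vector_Spaces.linear scale s (\<lambda>y. F x y z)"
    and "\<And>x y. Vector_Spaces.linear scale s (F x y)"
  shows "lift3 s F (tens3 x y z) = F x y z"
proof -
  interpret G: Vector_Spaces.linear scale s "F x y" by (rule assms)
  have "lift3 s F (tens3 x y z) =
      (\<Sum>i\<in>UNIV. s (dual_basis i x) (\<Sum>j\<in>UNIV. s (dual_basis j y)
        (\<Sum>k\<in>UNIV. s (dual_basis k z) (F (b i) (b j) (b k)))))"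
    by (simp only: lift3_def tens3_def vec_lambda_beta prod.case
        G.vs2.scale_scale[symmetric] G.vs2.scale_sum_right)
  also have "\<dots> = F x y z"
    by (simp only: linear_sum_dual_basis[OF assms(1)] linear_sum_dual_basis[OF assms(2)]
        linear_sum_dual_basis[OF assms(3)])
  finally show ?thesis .
qed

lemma lift4_tens4:
  assumes "\<And>y z w. Vector_Spaces.linear scale s (\<lambda>x. F x y z w)"
    and "\<And>x z w. Vector_Spaces.linear scale s (\<lambda>y. F x y z w)"
    and "\<And>x y w. Vector_Spaces.linear scale s (\<lambda>z. F x y z w)"
    and "\<And>x y z. Vector_Spaces.linear scale s (F x y z)"
  shows "lift4 s F (tens4 x y z w) = F x y z w"
proof -
  interpret G: Vector_Spaces.linear scale s "F x y z" by (rule assms)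
  have "lift4 s F (tens4 x y z w) =
      (\<Sum>i\<in>UNIV. s (dual_basis i x) (\<Sum>j\<in>UNIV. s (dual_basis j y)
        (\<Sum>k\<in>UNIV. s (dual_basis k z) (\<Sum>l\<in>UNIV. s (dual_basis l w)
          (F (b i) (b j) (b k) (b l))))))"
    by (simp only: lift4_def tens4_def vec_lambda_beta prod.case
        G.vs2.scale_scale[symmetric] G.vs2.scale_sum_right)
  also have "\<dots> = F x y z w"
    by (simp only: linear_sum_dual_basis[OF assms(1)] linear_sum_dual_basis[OF assms(2)]
        linear_sum_dual_basis[OF assms(3)] linear_sum_dual_basis[OF assms(4)])
  finally show ?thesis .
qed

lemma sum_mult_dual_basis: "(\<Sum>i\<in>UNIV. c i * dual_basis p (b i)) = c p"
proof -
  have "(\<Sum>i\<in>UNIV. c i * dual_basis p (b i)) = (\<Sum>i\<in>UNIV. if p = i then c i else 0)"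
    by (rule sum.cong) (simp_all add: dual_basis_basis)
  then show ?thesis
    by simp
qed

lemma lift2_tens2_self: "lift2 (*s) tens2 t = t"
  by (simp only: lift2_def tens2_def vec_eq_iff split_paired_All sum_component
      vector_smult_component vec_lambda_beta prod.case mult.assoc[symmetric]
      sum_distrib_right[symmetric] sum_mult_dual_basis) simp

lemma lift3_tens3_self: "lift3 (*s) tens3 t = t"
  by (simp only: lift3_def tens3_def vec_eq_iff split_paired_All sum_component
      vector_smult_component vec_lambda_beta prod.case mult.assoc[symmetric]
      sum_distrib_right[symmetric] sum_mult_dual_basis) simp

lemma lift4_tens4_self: "lift4 (*s) tens4 t = t"
  by (simp only: lift4_def tens4_def vec_eq_iff split_paired_All sum_component
      vector_smult_component vec_lambda_beta prod.case mult.assoc[symmetric]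
      sum_distrib_right[symmetric] sum_mult_dual_basis) simp

definition mult2 (infixl "\<odot>\<^sub>2" 70) where
  "t \<odot>\<^sub>2 t' = lift2 (*s) (\<lambda>x y. lift2 (*s) (\<lambda>x' y'. tens2 (x * x') (y * y')) t') t"

definition mult3 (infixl "\<odot>\<^sub>3" 70) where
  "t \<odot>\<^sub>3 t' = lift3 (*s) (\<lambda>x y z. lift3 (*s) (\<lambda>x' y' z'. tens3 (x * x') (y * y') (z * z')) t') t"

definition mult4 (infixl "\<odot>\<^sub>4" 70) where
  "t \<odot>\<^sub>4 t' = lift4 (*s) (\<lambda>x y z w.
     lift4 (*s) (\<lambda>x' y' z' w'. tens4 (x * x') (y * y') (z * z') (w * w')) t') t"

definition is_inverse2 :: "('k, 'i \<times> 'i) vec \<Rightarrow> ('k, 'i \<times> 'i) vec \<Rightarrow> bool" where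
  "is_inverse2 t t' \<longleftrightarrow> t \<odot>\<^sub>2 t' = tens2 1 1 \<and> t' \<odot>\<^sub>2 t = tens2 1 1"

definition is_inverse3 :: "('k, 'i \<times> 'i \<times> 'i) vec \<Rightarrow> ('k, 'i \<times> 'i \<times> 'i) vec \<Rightarrow> bool" where
  "is_inverse3 t t' \<longleftrightarrow> t \<odot>\<^sub>3 t' = tens3 1 1 1 \<and> t' \<odot>\<^sub>3 t = tens3 1 1 1"

definition inverse2 :: "('k, 'i \<times> 'i) vec \<Rightarrow> ('k, 'i \<times> 'i) vec" where
  "inverse2 t = (THE t'. is_inverse2 t t')"

definition inverse3 :: "('k, 'i \<times> 'i \<times> 'i) vec \<Rightarrow> ('k, 'i \<times> 'i \<times> 'i) vec" where
  "inverse3 t = (THE t'. is_inverse3 t t')"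

definition flip :: "('k, 'i \<times> 'i) vec \<Rightarrow> ('k, 'i \<times> 'i) vec" where
  "flip = lift2 (*s) (\<lambda>x y. tens2 y x)"

definition map2 :: "('a \<Rightarrow> 'a) \<Rightarrow> ('a \<Rightarrow> 'a) \<Rightarrow> ('k, 'i \<times> 'i) vec \<Rightarrow> ('k, 'i \<times> 'i) vec" where
  "map2 g h = lift2 (*s) (\<lambda>x y. tens2 (g x) (h y))"

text \<open>Separability: the multiplication map \<open>H \<otimes> H \<rightarrow> H\<close> splits as a map of
  bimodules, where \<open>H \<otimes> H\<close> carries the outer bimodule structure
  \<open>a (x \<otimes> y) c = a x \<otimes> y c\<close>, here written as \<open>(a \<otimes> 1) (x \<otimes> y) (1 \<otimes> c)\<close>.\<close>

definition separable_algebra :: bool where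
  "separable_algebra \<longleftrightarrow>
    (\<exists>\<sigma>. Vector_Spaces.linear scale (*s) \<sigma> \<and>
         (\<forall>a x c. \<sigma> (a * x * c) = tens2 a 1 \<odot>\<^sub>2 \<sigma> x \<odot>\<^sub>2 tens2 1 c) \<and>
         (\<forall>x. lift2 scale (*) (\<sigma> x) = x))"

end


section \<open>Quasi-bialgebras\<close>

locale quasi_bialgebra = fin_dim_algebra scale b
  for scale :: "'k::field \<Rightarrow> 'a::ring_1 \<Rightarrow> 'a" (infixr "\<cdot>" 75)
    and b :: "'i::finite \<Rightarrow> 'a" +
  fixes \<Delta> :: "'a \<Rightarrow> ('k, 'i \<times> 'i) vec"
    and \<epsilon> :: "'a \<Rightarrow> 'k"
    and \<phi> :: "('k, 'i \<times> 'i \<times> 'i) vec"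
  assumes linear_comult: "Vector_Spaces.linear scale (*s) \<Delta>"
    and comult_one: "\<Delta> 1 = tens2 1 1"
    and comult_mult: "\<Delta> (x * y) = \<Delta> x \<odot>\<^sub>2 \<Delta> y"
    and linear_counit: "Vector_Spaces.linear scale (*) \<epsilon>"
    and counit_one: "\<epsilon> 1 = 1"
    and counit_mult: "\<epsilon> (x * y) = \<epsilon> x * \<epsilon> y"
    and reassociator_invertible: "\<exists>\<psi>. is_inverse3 \<phi> \<psi>"
    and quasi_coassoc:
      "lift2 (*s) (\<lambda>x y. lift2 (*s) (\<lambda>y1 y2. tens3 x y1 y2) (\<Delta> y)) (\<Delta> a) \<odot>\<^sub>3 \<phi> =
       \<phi> \<odot>\<^sub>3 lift2 (*s) (\<lambda>x y. lift2 (*s) (\<lambda>x1 x2. tens3 x1 x2 y) (\<Delta> x)) (\<Delta> a)"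
    and pentagon:
      "lift3 (*s) (\<lambda>x y z. lift2 (*s) (\<lambda>z1 z2. tens4 x y z1 z2) (\<Delta> z)) \<phi> \<odot>\<^sub>4
       lift3 (*s) (\<lambda>x y z. lift2 (*s) (\<lambda>x1 x2. tens4 x1 x2 y z) (\<Delta> x)) \<phi> =
       lift3 (*s) (\<lambda>x y z. tens4 1 x y z) \<phi> \<odot>\<^sub>4
       lift3 (*s) (\<lambda>x y z. lift2 (*s) (\<lambda>y1 y2. tens4 x y1 y2 z) (\<Delta> y)) \<phi> \<odot>\<^sub>4
       lift3 (*s) (\<lambda>x y z. tens4 x y z 1) \<phi>"
    and counit_left: "lift2 scale (\<lambda>x y. \<epsilon> x \<cdot> y) (\<Delta> a) = a"
    and counit_right: "lift2 scale (\<lambda>x y. \<epsilon> y \<cdot> x) (\<Delta> a) = a"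
    and counit_reassociator: "lift3 (*s) (\<lambda>x y z. \<epsilon> y *s tens2 x z) \<phi> = tens2 1 1"
begin

definition left_integral :: "'a \<Rightarrow> bool" where
  "left_integral l \<longleftrightarrow> (\<forall>a. a * l = \<epsilon> a \<cdot> l)"

definition right_integral :: "'a \<Rightarrow> bool" where
  "right_integral l \<longleftrightarrow> (\<forall>a. l * a = \<epsilon> a \<cdot> l)"

definition normalized :: "'a \<Rightarrow> bool" where
  "normalized l \<longleftrightarrow> \<epsilon> l = 1"

definition haar_integral :: "'a \<Rightarrow> bool" where
  "haar_integral e \<longleftrightarrow> left_integral e \<and> right_integral e \<and> normalized e"

end


definition hit :: "'a::ring_1 \<Rightarrow> ('a \<Rightarrow> 'k) \<Rightarrow> 'a \<Rightarrow> 'k" (infixr "\<rightharpoonup>" 60) where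
  "(a \<rightharpoonup> \<psi>) = (\<lambda>x. \<psi> (x * a))"


section \<open>Quasi-Hopf algebras and the space of left cointegrals\<close>

text \<open>The antipode is invertible and \<open>\<alpha>\<close>, \<open>\<beta>\<close> are normalized by
  \<open>\<epsilon> \<alpha> = \<epsilon> \<beta> = 1\<close>.\<close>

locale quasi_hopf_algebra = quasi_bialgebra scale b \<Delta> \<epsilon> \<phi>
  for scale :: "'k::field \<Rightarrow> 'a::ring_1 \<Rightarrow> 'a" (infixr "\<cdot>" 75)
    and b :: "'i::finite \<Rightarrow> 'a"
    and \<Delta> :: "'a \<Rightarrow> ('k, 'i \<times> 'i) vec"
    and \<epsilon> :: "'a \<Rightarrow> 'k"
    and \<phi> :: "('k, 'i \<times> 'i \<times> 'i) vec" +
  fixes S :: "'a \<Rightarrow> 'a"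
    and \<alpha> :: 'a
    and \<beta> :: 'a
  assumes linear_antipode: "Vector_Spaces.linear scale scale S"
    and antipode_one: "S 1 = 1"
    and antipode_mult: "S (x * y) = S y * S x"
    and bij_antipode: "bij S"
    and antipode_alpha: "lift2 scale (\<lambda>x y. S x * \<alpha> * y) (\<Delta> a) = \<epsilon> a \<cdot> \<alpha>"
    and antipode_beta: "lift2 scale (\<lambda>x y. x * \<beta> * S y) (\<Delta> a) = \<epsilon> a \<cdot> \<beta>"
    and antipode_reassociator: "lift3 scale (\<lambda>x y z. x * \<beta> * S y * \<alpha> * z) \<phi> = 1"
    and antipode_reassociator_inverse:
      "lift3 scale (\<lambda>x y z. S x * \<alpha> * y * \<beta> * S z) (inverse3 \<phi>) = 1"
    and counit_alpha: "\<epsilon> \<alpha> = 1"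
    and counit_beta: "\<epsilon> \<beta> = 1"
begin

definition q_R :: "('k, 'i \<times> 'i) vec" where
  "q_R = lift3 (*s) (\<lambda>x y z. tens2 x (inv S (\<alpha> * z) * y)) \<phi>"

definition p_R :: "('k, 'i \<times> 'i) vec" where
  "p_R = lift3 (*s) (\<lambda>x y z. tens2 x (y * \<beta> * S z)) (inverse3 \<phi>)"

definition gamma :: "('k, 'i \<times> 'i) vec" where
  "gamma = lift4 (*s) (\<lambda>t u v w. tens2 (S u * \<alpha> * v) (S t * \<alpha> * w))
     (lift3 (*s) (\<lambda>x y z. tens4 1 x y z) (inverse3 \<phi>) \<odot>\<^sub>4
      lift3 (*s) (\<lambda>x y z. lift2 (*s) (\<lambda>z1 z2. tens4 x y z1 z2) (\<Delta> z)) \<phi>)"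

definition drinfeld :: "('k, 'i \<times> 'i) vec" where
  "drinfeld = lift3 (*s)
     (\<lambda>x y z. map2 S S (flip (\<Delta> x)) \<odot>\<^sub>2 gamma \<odot>\<^sub>2 \<Delta> (y * \<beta> * S z)) (inverse3 \<phi>)"

definition h_elem :: "('k, 'i \<times> 'i) vec" where
  "h_elem = map2 (inv S) (inv S) (flip drinfeld)"

definition U_elem :: "('k, 'i \<times> 'i) vec" where
  "U_elem = inverse2 drinfeld \<odot>\<^sub>2 map2 S S (flip q_R)"

definition V_elem :: "('k, 'i \<times> 'i) vec" where
  "V_elem = map2 (inv S) (inv S) (flip p_R) \<odot>\<^sub>2 h_elem"

definition Delta_bar :: "'a \<Rightarrow> ('k, 'i \<times> 'i) vec" where
  "Delta_bar a = V_elem \<odot>\<^sub>2 \<Delta> a \<odot>\<^sub>2 U_elem"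

definition coint_proj :: "('a \<Rightarrow> 'k) \<Rightarrow> 'a \<Rightarrow> 'k" where
  "coint_proj \<psi> a =
    (\<Sum>i\<in>UNIV. lift2 (*) (\<lambda>x y. dual_basis i x * \<psi> y)
       (lift2 (*s) (\<lambda>q1 q2. Delta_bar (inv S q1 * a * S (S (q2 * b i)) * S \<beta>)) q_R))"

text \<open>For a finite-dimensional quasi-Hopf algebra, \<open>coint_proj\<close> is a projection of the dual space
  onto the space of left cointegrals, which is therefore introduced as its image.\<close>

definition left_cointegrals :: "('a \<Rightarrow> 'k) set" where
  "left_cointegrals = coint_proj ` {\<psi>. Vector_Spaces.linear scale (*) \<psi>}"

definition lambda_e :: "'a \<Rightarrow> 'k" where
  "lambda_e = coint_proj \<epsilon>"

end

end

theory Submission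
  imports Defs
begin

text \<open>Let \<open>w = X l\<^sub>1 \<otimes> S(Y l\<^sub>2) \<alpha> Z\<close> for a left integral \<open>l\<close>.  Quasi-coassociativity gives
  \<open>(a \<otimes> 1) w = w (1 \<otimes> a)\<close>, so inserting \<open>\<beta>\<close> between the two legs of \<open>w\<close> yields a separability
  idempotent when \<open>\<epsilon>(l) = 1\<close>.  Conversely, a complement of the left ideal \<open>ker \<epsilon>\<close> contains a
  normalized left integral.

  By cyclicity of the trace, \<open>\<lambda>\<^sub>e(a)\<close> is the trace of \<open>x \<mapsto> S(\<alpha>) S\<^sup>2(\<beta> x) S(a)\<close>, which is a
  composite \<open>k \<rightarrow> H \<otimes> H\<^sup>* \<rightarrow> k\<close> of module maps.  As \<open>H \<otimes> H\<^sup>*\<close> is a direct summand of a free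
  module, this composite is \<open>\<epsilon>(l)\<close> for an explicit left integral \<open>l\<close>; hence \<open>\<lambda>\<^sub>e \<noteq> 0\<close> forces a
  normalized one.

  The formula for \<open>\<lambda>\<^sub>e\<close> needs the value of \<open>id \<otimes> \<epsilon>\<close> at the inverse of \<open>f\<close>, hence Drinfeld's
  theorem that \<open>f\<close> is invertible.  The maps \<open>\<Delta> \<circ> S\<close> and \<open>(S \<otimes> S) \<circ> \<Delta>\<^sup>o\<^sup>p\<close> are both antipodes for
  \<open>\<Delta>: H \<rightarrow> H \<otimes> H\<close>, with evaluation and coevaluation elements \<open>\<Delta>(\<alpha>), \<Delta>(\<beta>)\<close> and \<open>\<gamma>, \<delta>\<close>.  As \<open>f\<close>
  compares them, the comparison in the other direction is a left inverse of \<open>f\<close>, and this suffices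
  in the finite-dimensional algebra \<open>H \<otimes> H\<close>.\<close>

section \<open>Multilinear maps and tensors\<close>

lemma linearI:
  assumes "vector_space s" "vector_space s'"
    and "\<And>x y. f (x + y) = f x + f y" and "\<And>c x. f (s c x) = s' c (f x)"
  shows "Vector_Spaces.linear s s' f"
  using assms by (simp add: Vector_Spaces.linear_iff)

lemma linear_identity: "vector_space s \<Longrightarrow> Vector_Spaces.linear s s (\<lambda>x. x)"
  by (rule linearI) auto

lemma linear_comp:
  assumes "Vector_Spaces.linear s' s'' f" and "Vector_Spaces.linear s s' g"
  shows "Vector_Spaces.linear s s'' (\<lambda>x. f (g x))"
  using assms by (simp add: Vector_Spaces.linear_iff)

lemma linear_multiple_right:
  assumes "Vector_Spaces.linear s s' f"
  shows "Vector_Spaces.linear s s' (\<lambda>x. s' c (f x))"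
proof -
  interpret Vector_Spaces.linear s s' f by fact
  show ?thesis
    by (rule linearI) (auto intro: vs1.vector_space_axioms vs2.vector_space_axioms
        simp: add scale vs2.scale_right_distrib vs2.scale_left_commute)
qed

lemma linear_multiple_left:
  assumes "Vector_Spaces.linear s (*) f" and "vector_space s'"
  shows "Vector_Spaces.linear s s' (\<lambda>x. s' (f x) w)"
proof -
  interpret Vector_Spaces.linear s "(*)" f by fact
  interpret vector_space s' by fact
  show ?thesis
    by (rule linearI) (auto intro: vs1.vector_space_axioms assms
        simp: add scale scale_left_distrib)
qed

lemma linear_sum:
  assumes "vector_space s" "vector_space s'" and "\<And>i. Vector_Spaces.linear s s' (f i)"
  shows "Vector_Spaces.linear s s' (\<lambda>x. \<Sum>i\<in>I. f i x)"
proof -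
  interpret vector_space s' by fact
  show ?thesis
    using assms(3)
    by (intro linearI assms) (auto simp: Vector_Spaces.linear_iff sum.distrib scale_sum_right)
qed

lemmas linear_multiple_right_field = linear_multiple_right[of _ "(*)"]
lemmas linear_multiple_left_field =
  linear_multiple_left[OF _ vector_space_over_itself.vector_space_axioms]
lemmas linear_multiple_right_vec = linear_multiple_right[of _ "(*s)"]
lemmas linear_multiple_left_vec = linear_multiple_left[OF _ vec.vector_space_axioms]

context fin_dim_algebra
begin

abbreviation lin :: "('a \<Rightarrow> 'w) \<Rightarrow> ('k \<Rightarrow> 'w \<Rightarrow> 'w::ab_group_add) \<Rightarrow> bool" where
  "lin f s \<equiv> Vector_Spaces.linear scale s f"

text \<open>\<open>Vector_Spaces.linear\<close> contains the vector space axioms of its codomain, so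
  linearity slot by slot already records that \<open>s\<close> is a vector space.\<close>

definition bilin :: "('k \<Rightarrow> 'w \<Rightarrow> 'w) \<Rightarrow> ('a \<Rightarrow> 'a \<Rightarrow> 'w::ab_group_add) \<Rightarrow> bool" where
  "bilin s F \<longleftrightarrow> (\<forall>y. lin (\<lambda>x. F x y) s) \<and> (\<forall>x. lin (\<lambda>y. F x y) s)"

definition trilin :: "('k \<Rightarrow> 'w \<Rightarrow> 'w) \<Rightarrow> ('a \<Rightarrow> 'a \<Rightarrow> 'a \<Rightarrow> 'w::ab_group_add) \<Rightarrow> bool" where
  "trilin s F \<longleftrightarrow> (\<forall>y z. lin (\<lambda>x. F x y z) s) \<and> (\<forall>x z. lin (\<lambda>y. F x y z) s) \<and>
     (\<forall>x y. lin (\<lambda>z. F x y z) s)"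

definition quadlin ::
    "('k \<Rightarrow> 'w \<Rightarrow> 'w) \<Rightarrow> ('a \<Rightarrow> 'a \<Rightarrow> 'a \<Rightarrow> 'a \<Rightarrow> 'w::ab_group_add) \<Rightarrow> bool" where
  "quadlin s F \<longleftrightarrow> (\<forall>y z w. lin (\<lambda>x. F x y z w) s) \<and> (\<forall>x z w. lin (\<lambda>y. F x y z w) s) \<and>
     (\<forall>x y w. lin (\<lambda>z. F x y z w) s) \<and> (\<forall>x y z. lin (\<lambda>w. F x y z w) s)"

lemma bilinI:
  assumes "\<And>y. lin (\<lambda>x. F x y) s" "\<And>x. lin (\<lambda>y. F x y) s"
  shows "bilin s F"
  using assms by (simp add: bilin_def)

lemma trilinI:
  assumes "\<And>y z. lin (\<lambda>x. F x y z) s" "\<And>x z. lin (\<lambda>y. F x y z) s" "\<And>x y. lin (\<lambda>z. F x y z) s"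
  shows "trilin s F"
  using assms by (simp add: trilin_def)

lemma quadlinI:
  assumes "\<And>y z w. lin (\<lambda>x. F x y z w) s" "\<And>x z w. lin (\<lambda>y. F x y z w) s"
    "\<And>x y w. lin (\<lambda>z. F x y z w) s" "\<And>x y z. lin (\<lambda>w. F x y z w) s"
  shows "quadlin s F"
  using assms by (simp add: quadlin_def)

text \<open>The inner linear map \<open>g\<close> lets an abstract multilinear \<open>F\<close> take
  part in structural linearity proofs: a variable buried in an argument of \<open>F\<close> is
  reached through \<open>g\<close>.\<close>

lemma bilinD:
  assumes "bilin s F"
  shows "Vector_Spaces.linear s' scale g \<Longrightarrow> Vector_Spaces.linear s' s (\<lambda>x. F (g x) y)"
    and "Vector_Spaces.linear s' scale g \<Longrightarrow> Vector_Spaces.linear s' s (\<lambda>x. F y (g x))"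
    and "vector_space s"
  using assms by (auto simp: bilin_def Vector_Spaces.linear_iff)

lemma trilinD:
  assumes "trilin s F"
  shows "Vector_Spaces.linear s' scale g \<Longrightarrow> Vector_Spaces.linear s' s (\<lambda>x. F (g x) y z)"
    and "Vector_Spaces.linear s' scale g \<Longrightarrow> Vector_Spaces.linear s' s (\<lambda>x. F y (g x) z)"
    and "Vector_Spaces.linear s' scale g \<Longrightarrow> Vector_Spaces.linear s' s (\<lambda>x. F y z (g x))"
    and "vector_space s"
  using assms by (auto simp: trilin_def Vector_Spaces.linear_iff)

lemma quadlinD:
  assumes "quadlin s F"
  shows "Vector_Spaces.linear s' scale g \<Longrightarrow> Vector_Spaces.linear s' s (\<lambda>x. F (g x) y z w)"
    and "Vector_Spaces.linear s' scale g \<Longrightarrow> Vector_Spaces.linear s' s (\<lambda>x. F y (g x) z w)"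
    and "Vector_Spaces.linear s' scale g \<Longrightarrow> Vector_Spaces.linear s' s (\<lambda>x. F y z (g x) w)"
    and "Vector_Spaces.linear s' scale g \<Longrightarrow> Vector_Spaces.linear s' s (\<lambda>x. F y z w (g x))"
    and "vector_space s"
  using assms by (auto simp: quadlin_def Vector_Spaces.linear_iff)

section \<open>Linear extension to tensors and calculus of Sweedler sums\<close>

lemma lift2_sum:
  "lift2 s F t = (\<Sum>p\<in>UNIV. s (t $ p) (F (b (fst p)) (b (snd p))))"
  by (simp add: lift2_def sum.cartesian_product case_prod_unfold)

lemma lift3_sum:
  "lift3 s F t = (\<Sum>p\<in>UNIV. s (t $ p) (F (b (fst p)) (b (fst (snd p))) (b (snd (snd p)))))"
  by (simp add: lift3_def sum.cartesian_product case_prod_unfold)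

lemma lift4_sum:
  "lift4 s F t = (\<Sum>p\<in>UNIV. s (t $ p)
     (F (b (fst p)) (b (fst (snd p))) (b (fst (snd (snd p)))) (b (snd (snd (snd p))))))"
  by (simp add: lift4_def sum.cartesian_product case_prod_unfold)

lemmas lift_sum = lift2_sum lift3_sum lift4_sum

lemma linear_lift2_tensor:
  assumes "vector_space s" "Vector_Spaces.linear s' (*s) T2"
  shows "Vector_Spaces.linear s' s (\<lambda>x. lift2 s F2 (T2 x))"
proof -
  interpret W: vector_space s by fact
  have "Vector_Spaces.linear (*s) s (lift2 s F2)"
    by (rule linearI) (auto intro: assms vec.vector_space_axioms
      simp: lift_sum W.scale_left_distrib sum.distrib W.scale_sum_right)
  then show ?thesis by (rule linear_comp) fact
qed

lemma linear_lift3_tensor: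
  assumes "vector_space s" "Vector_Spaces.linear s' (*s) T3"
  shows "Vector_Spaces.linear s' s (\<lambda>x. lift3 s F3 (T3 x))"
proof -
  interpret W: vector_space s by fact
  have "Vector_Spaces.linear (*s) s (lift3 s F3)"
    by (rule linearI) (auto intro: assms vec.vector_space_axioms
      simp: lift_sum W.scale_left_distrib sum.distrib W.scale_sum_right)
  then show ?thesis by (rule linear_comp) fact
qed

lemma linear_lift4_tensor:
  assumes "vector_space s" "Vector_Spaces.linear s' (*s) T4"
  shows "Vector_Spaces.linear s' s (\<lambda>x. lift4 s F4 (T4 x))"
proof -
  interpret W: vector_space s by fact
  have "Vector_Spaces.linear (*s) s (lift4 s F4)"
    by (rule linearI) (auto intro: assms vec.vector_space_axioms
      simp: lift_sum W.scale_left_distrib sum.distrib W.scale_sum_right)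
  then show ?thesis by (rule linear_comp) fact
qed

text \<open>Sweedler sums nest, so besides linearity in the tensor one needs linearity in a
  parameter \<open>w\<close> of the map being extended.\<close>

lemma linear_lift_body:
  shows "(\<And>x y. Vector_Spaces.linear s' s (\<lambda>w. F2 w x y)) \<Longrightarrow>
      Vector_Spaces.linear s' s (\<lambda>w. lift2 s (F2 w) t2)"
    and "(\<And>x y z. Vector_Spaces.linear s' s (\<lambda>w. F3 w x y z)) \<Longrightarrow>
      Vector_Spaces.linear s' s (\<lambda>w. lift3 s (F3 w) t3)"
    and "(\<And>x y z u. Vector_Spaces.linear s' s (\<lambda>w. F4 w x y z u)) \<Longrightarrow>
      Vector_Spaces.linear s' s (\<lambda>w. lift4 s (F4 w) t4)"
  unfolding lift_sum
  by (rule linear_sum linear_multiple_right | assumption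
      | force simp: Vector_Spaces.linear_iff)+

text \<open>Linear maps commute with finite sums and scalars, so \<open>f\<close> moves under a
  Sweedler sum. The pushing rules below come from this principle.\<close>

lemma lift2_apply:
  assumes "Vector_Spaces.linear s s' f"
  shows "f (lift2 s F t) = lift2 s' (\<lambda>x y. f (F x y)) t"
proof -
  interpret Vector_Spaces.linear s s' f by fact
  show ?thesis by (simp add: lift_sum sum scale)
qed

lemma lift3_apply:
  assumes "Vector_Spaces.linear s s' f"
  shows "f (lift3 s F t) = lift3 s' (\<lambda>x y z. f (F x y z)) t"
proof -
  interpret Vector_Spaces.linear s s' f by fact
  show ?thesis by (simp add: lift_sum sum scale)
qed

lemma lift4_apply:
  assumes "Vector_Spaces.linear s s' f"
  shows "f (lift4 s F t) = lift4 s' (\<lambda>x y z w. f (F x y z w)) t"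
proof -
  interpret Vector_Spaces.linear s s' f by fact
  show ?thesis by (simp add: lift_sum sum scale)
qed

lemma
  assumes "vector_space s"
  shows lift2_lift2_commute: "lift2 s (\<lambda>x y. lift2 s (F22 x y) u2) t2 =
      lift2 s (\<lambda>x' y'. lift2 s (\<lambda>x y. F22 x y x' y') t2) u2"
    and lift2_lift3_commute: "lift2 s (\<lambda>x y. lift3 s (F23 x y) u3) t2 =
      lift3 s (\<lambda>x' y' z'. lift2 s (\<lambda>x y. F23 x y x' y' z') t2) u3"
    and lift3_lift3_commute: "lift3 s (\<lambda>x y z. lift3 s (F33 x y z) u3) t3 =
      lift3 s (\<lambda>x' y' z'. lift3 s (\<lambda>x y z. F33 x y z x' y' z') t3) u3"
proof -
  interpret W: vector_space s by fact
  show "lift2 s (\<lambda>x y. lift2 s (F22 x y) u2) t2 =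
      lift2 s (\<lambda>x' y'. lift2 s (\<lambda>x y. F22 x y x' y') t2) u2"
    unfolding lift_sum W.scale_sum_right by (subst sum.swap) (simp add: mult.commute)
  show "lift2 s (\<lambda>x y. lift3 s (F23 x y) u3) t2 =
      lift3 s (\<lambda>x' y' z'. lift2 s (\<lambda>x y. F23 x y x' y' z') t2) u3"
    unfolding lift_sum W.scale_sum_right by (subst sum.swap) (simp add: mult.commute)
  show "lift3 s (\<lambda>x y z. lift3 s (F33 x y z) u3) t3 =
      lift3 s (\<lambda>x' y' z'. lift3 s (\<lambda>x y z. F33 x y z x' y' z') t3) u3"
    unfolding lift_sum W.scale_sum_right by (subst sum.swap) (simp add: mult.commute)
qed

lemma lift2_tens2_bilin: "bilin s F \<Longrightarrow> lift2 s F (tens2 x y) = F x y"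
  by (rule lift2_tens2) (auto simp: bilin_def)

lemma lift3_tens3_trilin: "trilin s F \<Longrightarrow> lift3 s F (tens3 x y z) = F x y z"
  by (rule lift3_tens3) (auto simp: trilin_def)

lemma lift4_tens4_quadlin: "quadlin s F \<Longrightarrow> lift4 s F (tens4 x y z w) = F x y z w"
  by (rule lift4_tens4) (auto simp: quadlin_def)

lemma linear_dual_basis: "lin (dual_basis i) (*)"
  by (rule linearI)
     (auto simp: dual_basis_def representation_add representation_scale independent_basis span_basis
       intro: vector_space_axioms vector_space_over_itself.vector_space_axioms)

lemma linear_mult:
  assumes "Vector_Spaces.linear s scale g"
  shows "Vector_Spaces.linear s scale (\<lambda>x. g x * c)" "Vector_Spaces.linear s scale (\<lambda>x. c * g x)"
  using assms
  by (auto simp: Vector_Spaces.linear_iff distrib_left distrib_right scale_mult_left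
      scale_mult_right)

lemma linear_tens:
  assumes "Vector_Spaces.linear s scale g"
  shows "Vector_Spaces.linear s (*s) (\<lambda>x. tens2 (g x) y)"
    "Vector_Spaces.linear s (*s) (\<lambda>x. tens2 y (g x))"
    "Vector_Spaces.linear s (*s) (\<lambda>x. tens3 (g x) y z)"
    "Vector_Spaces.linear s (*s) (\<lambda>x. tens3 y (g x) z)"
    "Vector_Spaces.linear s (*s) (\<lambda>x. tens3 y z (g x))"
    "Vector_Spaces.linear s (*s) (\<lambda>x. tens4 (g x) y z w)"
    "Vector_Spaces.linear s (*s) (\<lambda>x. tens4 y (g x) z w)"
    "Vector_Spaces.linear s (*s) (\<lambda>x. tens4 y z (g x) w)"
    "Vector_Spaces.linear s (*s) (\<lambda>x. tens4 y z w (g x))"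
proof -
  have *: "Vector_Spaces.linear s (*) (\<lambda>x. dual_basis i (g x))" for i
    by (rule linear_comp[OF linear_dual_basis assms])
  show "Vector_Spaces.linear s (*s) (\<lambda>x. tens2 (g x) y)"
    "Vector_Spaces.linear s (*s) (\<lambda>x. tens2 y (g x))"
    "Vector_Spaces.linear s (*s) (\<lambda>x. tens3 (g x) y z)"
    "Vector_Spaces.linear s (*s) (\<lambda>x. tens3 y (g x) z)"
    "Vector_Spaces.linear s (*s) (\<lambda>x. tens3 y z (g x))"
    "Vector_Spaces.linear s (*s) (\<lambda>x. tens4 (g x) y z w)"
    "Vector_Spaces.linear s (*s) (\<lambda>x. tens4 y (g x) z w)"
    "Vector_Spaces.linear s (*s) (\<lambda>x. tens4 y z (g x) w)"
    "Vector_Spaces.linear s (*s) (\<lambda>x. tens4 y z w (g x))"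
    using assms *
    by (auto simp: Vector_Spaces.linear_iff vec_eq_iff tens2_def tens3_def tens4_def
        algebra_simps vec.vector_space_axioms)
qed

lemmas vector_space_facts = vector_space_axioms vec.vector_space_axioms
  vector_space_over_itself.vector_space_axioms

text \<open>Structural rules: the outermost operation of an expression is peeled off until the
  identity in the chosen variable remains. This discharges the multilinearity side
  conditions.\<close>

lemmas linear_intros = allI conjI bilinI trilinI quadlinI
  linear_identity[OF vector_space_axioms] linear_identity[OF vec.vector_space_axioms]
  linear_mult linear_tens linear_lift_body
  linear_lift2_tensor linear_lift3_tensor linear_lift4_tensor vector_space_facts
  linear_multiple_left_field linear_multiple_right_field linear_multiple_left_vec
      linear_multiple_right_vec
  linear_multiple_right[of _ scale] linear_multiple_left[OF _ vector_space_axioms]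
  linear_comp[OF linear_dual_basis]

section \<open>The tensor powers as associative algebras\<close>

lemma lift2_mult2:
  assumes "bilin s F"
  shows "lift2 s F (t \<odot>\<^sub>2 u) = lift2 s (\<lambda>x y. lift2 s (\<lambda>x' y'. F (x * x') (y * y')) u) t"
  unfolding mult2_def
  by (simp add: lift2_apply[OF linear_lift2_tensor[OF bilinD(3)[OF assms]
        linear_identity[OF vec.vector_space_axioms]]] lift2_tens2_bilin[OF assms])

lemma lift3_mult3:
  assumes "trilin s F"
  shows "lift3 s F (t \<odot>\<^sub>3 u) =
    lift3 s (\<lambda>x y z. lift3 s (\<lambda>x' y' z'. F (x * x') (y * y') (z * z')) u) t"
  unfolding mult3_def
  by (simp add: lift3_apply[OF linear_lift3_tensor[OF trilinD(4)[OF assms]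
        linear_identity[OF vec.vector_space_axioms]]] lift3_tens3_trilin[OF assms])

lemma lift4_mult4:
  assumes "quadlin s F"
  shows "lift4 s F (t \<odot>\<^sub>4 u) = lift4 s (\<lambda>x y z w. lift4 s (\<lambda>x' y' z' w'.
    F (x * x') (y * y') (z * z') (w * w')) u) t"
  unfolding mult4_def
  by (simp add: lift4_apply[OF linear_lift4_tensor[OF quadlinD(5)[OF assms]
        linear_identity[OF vec.vector_space_axioms]]] lift4_tens4_quadlin[OF assms])

lemma linear_mult2:
  assumes "Vector_Spaces.linear s (*s) T"
  shows "Vector_Spaces.linear s (*s) (\<lambda>x. T x \<odot>\<^sub>2 u)"
    and "Vector_Spaces.linear s (*s) (\<lambda>x. u \<odot>\<^sub>2 T x)"
  unfolding mult2_def by (intro linear_intros assms)+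

lemma linear_mult3:
  assumes "Vector_Spaces.linear s (*s) T"
  shows "Vector_Spaces.linear s (*s) (\<lambda>x. T x \<odot>\<^sub>3 u)"
    and "Vector_Spaces.linear s (*s) (\<lambda>x. u \<odot>\<^sub>3 T x)"
  unfolding mult3_def by (intro linear_intros assms)+

lemma linear_mult4:
  assumes "Vector_Spaces.linear s (*s) T"
  shows "Vector_Spaces.linear s (*s) (\<lambda>x. T x \<odot>\<^sub>4 u)"
    and "Vector_Spaces.linear s (*s) (\<lambda>x. u \<odot>\<^sub>4 T x)"
  unfolding mult4_def by (intro linear_intros assms)+

lemma mult2_assoc: "t \<odot>\<^sub>2 u \<odot>\<^sub>2 v = t \<odot>\<^sub>2 (u \<odot>\<^sub>2 v)"
proof -
  have "t \<odot>\<^sub>2 u \<odot>\<^sub>2 v = lift2 (*s) (\<lambda>x y. lift2 (*s) (\<lambda>x' y'. lift2 (*s)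
      (\<lambda>x'' y''. tens2 (x * x' * x'') (y * y' * y'')) v) u) t"
    by (subst mult2_def, subst lift2_mult2) (intro linear_intros refl)+
  also have "\<dots> = t \<odot>\<^sub>2 (u \<odot>\<^sub>2 v)"
    by (subst mult2_def[of t], subst lift2_mult2) (intro linear_intros, simp add: mult.assoc)
  finally show ?thesis .
qed

lemma mult3_assoc: "t \<odot>\<^sub>3 u \<odot>\<^sub>3 v = t \<odot>\<^sub>3 (u \<odot>\<^sub>3 v)"
proof -
  have "t \<odot>\<^sub>3 u \<odot>\<^sub>3 v = lift3 (*s) (\<lambda>x y z. lift3 (*s) (\<lambda>x' y' z'. lift3 (*s)
      (\<lambda>x'' y'' z''. tens3 (x * x' * x'') (y * y' * y'') (z * z' * z'')) v) u) t"
    by (subst mult3_def, subst lift3_mult3) (intro linear_intros refl)+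
  also have "\<dots> = t \<odot>\<^sub>3 (u \<odot>\<^sub>3 v)"
    by (subst mult3_def[of t], subst lift3_mult3) (intro linear_intros, simp add: mult.assoc)
  finally show ?thesis .
qed

lemma mult4_assoc: "t \<odot>\<^sub>4 u \<odot>\<^sub>4 v = t \<odot>\<^sub>4 (u \<odot>\<^sub>4 v)"
proof -
  have "t \<odot>\<^sub>4 u \<odot>\<^sub>4 v = lift4 (*s) (\<lambda>x y z w. lift4 (*s) (\<lambda>x' y' z' w'. lift4 (*s)
      (\<lambda>x'' y'' z'' w''. tens4 (x * x' * x'') (y * y' * y'') (z * z' * z'') (w * w' * w'')) v) u) t"
    by (subst mult4_def, subst lift4_mult4) (intro linear_intros refl)+
  also have "\<dots> = t \<odot>\<^sub>4 (u \<odot>\<^sub>4 v)"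
    by (subst mult4_def[of t], subst lift4_mult4) (intro linear_intros, simp add: mult.assoc)
  finally show ?thesis .
qed

lemma mult2_tens2: "tens2 x y \<odot>\<^sub>2 tens2 x' y' = tens2 (x * x') (y * y')"
  unfolding mult2_def by (subst lift2_tens2_bilin, intro linear_intros)+ simp

lemma mult4_tens4: "tens4 x y z w \<odot>\<^sub>4 tens4 x' y' z' w' = tens4 (x * x') (y * y') (z * z') (w * w')"
  unfolding mult4_def by (subst lift4_tens4_quadlin, intro linear_intros)+ simp

lemma mult2_one: "tens2 1 1 \<odot>\<^sub>2 t = t" "t \<odot>\<^sub>2 tens2 1 1 = t"
  unfolding mult2_def by (subst lift2_tens2_bilin, intro linear_intros, simp add: lift2_tens2_self)+

lemma mult3_one: "tens3 1 1 1 \<odot>\<^sub>3 t = t" "t \<odot>\<^sub>3 tens3 1 1 1 = t"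
  unfolding mult3_def by (subst lift3_tens3_trilin, intro linear_intros, simp add:
      lift3_tens3_self)+

lemma mult4_one: "tens4 1 1 1 1 \<odot>\<^sub>4 t = t" "t \<odot>\<^sub>4 tens4 1 1 1 1 = t"
  unfolding mult4_def by (subst lift4_tens4_quadlin, intro linear_intros, simp add:
      lift4_tens4_self)+

text \<open>Extension maps are themselves linear in the tensor. An extension applied to a Sweedler
  sum of tensors thus becomes a nested Sweedler sum.\<close>

lemma lift_push:
  assumes "vector_space s"
  shows "lift2 s G2 (lift2 (*s) (F22 :: 'a \<Rightarrow> 'a \<Rightarrow> ('k, 'i \<times> 'i) vec) t2) =
      lift2 s (\<lambda>x y. lift2 s G2 (F22 x y)) t2"
    and "lift2 s G2 (lift3 (*s) F32 t3) = lift3 s (\<lambda>x y z. lift2 s G2 (F32 x y z)) t3"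
    and "lift3 s G3 (lift2 (*s) F23 t2) = lift2 s (\<lambda>x y. lift3 s G3 (F23 x y)) t2"
    and "lift3 s G3 (lift3 (*s) F33 t3) = lift3 s (\<lambda>x y z. lift3 s G3 (F33 x y z)) t3"
    and "lift4 s G4 (lift2 (*s) F24 t2) = lift2 s (\<lambda>x y. lift4 s G4 (F24 x y)) t2"
    and "lift4 s G4 (lift3 (*s) F34 t3) = lift3 s (\<lambda>x y z. lift4 s G4 (F34 x y z)) t3"
  by (fact lift2_apply[OF linear_lift2_tensor[OF assms linear_identity[OF vec.vector_space_axioms]]]
    lift3_apply[OF linear_lift2_tensor[OF assms linear_identity[OF vec.vector_space_axioms]]]
    lift2_apply[OF linear_lift3_tensor[OF assms linear_identity[OF vec.vector_space_axioms]]]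
    lift3_apply[OF linear_lift3_tensor[OF assms linear_identity[OF vec.vector_space_axioms]]]
    lift2_apply[OF linear_lift4_tensor[OF assms linear_identity[OF vec.vector_space_axioms]]]
    lift3_apply[OF linear_lift4_tensor[OF assms linear_identity[OF vec.vector_space_axioms]]])+

text \<open>Both sides are linear in each tensor, so multiplicativity on pure tensors is enough. The
  next lemmas repeat this for other source and target powers.\<close>

lemma lift3_mult4_hom:
  assumes "trilin (*s) M"
    and "\<And>x y z x' y' z'. M (x * x') (y * y') (z * z') = M x y z \<odot>\<^sub>4 M x' y' z'"
  shows "lift3 (*s) M (t \<odot>\<^sub>3 u) = lift3 (*s) M t \<odot>\<^sub>4 lift3 (*s) M u"
  unfolding lift3_mult3[OF assms(1)] assms(2)
  by (simp only: lift3_apply[OF linear_mult4(1)[OF linear_identity[OF vec.vector_space_axioms]]])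
    (simp only: lift3_apply[OF linear_mult4(2)[OF linear_identity[OF vec.vector_space_axioms]]])

lemma lift3_mult2_hom:
  assumes "trilin (*s) M"
    and "\<And>x y z x' y' z'. M (x * x') (y * y') (z * z') = M x y z \<odot>\<^sub>2 M x' y' z'"
  shows "lift3 (*s) M (t \<odot>\<^sub>3 u) = lift3 (*s) M t \<odot>\<^sub>2 lift3 (*s) M u"
  unfolding lift3_mult3[OF assms(1)] assms(2)
  by (simp only: lift3_apply[OF linear_mult2(1)[OF linear_identity[OF vec.vector_space_axioms]]])
    (simp only: lift3_apply[OF linear_mult2(2)[OF linear_identity[OF vec.vector_space_axioms]]])

lemma lift4_mult2_hom:
  assumes "quadlin (*s) M"
    and "\<And>x y z w x' y' z' w'.
      M (x * x') (y * y') (z * z') (w * w') = M x y z w \<odot>\<^sub>2 M x' y' z' w'"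
  shows "lift4 (*s) M (t \<odot>\<^sub>4 u) = lift4 (*s) M t \<odot>\<^sub>2 lift4 (*s) M u"
  unfolding lift4_mult4[OF assms(1)] assms(2)
  by (simp only: lift4_apply[OF linear_mult2(1)[OF linear_identity[OF vec.vector_space_axioms]]])
    (simp only: lift4_apply[OF linear_mult2(2)[OF linear_identity[OF vec.vector_space_axioms]]])

lemma lift2_mult_hom:
  assumes "bilin scale M"
    and "\<And>x y x' y'. M (x * x') (y * y') = M x y * M x' y'"
  shows "lift2 scale M (t \<odot>\<^sub>2 u) = lift2 scale M t * lift2 scale M u"
  unfolding lift2_mult2[OF assms(1)] assms(2)
  by (simp only: lift2_apply[OF linear_mult(1)[OF linear_identity[OF vector_space_axioms]]])
    (simp only: lift2_apply[OF linear_mult(2)[OF linear_identity[OF vector_space_axioms]]])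

section \<open>Inverses in the tensor powers\<close>

lemma inverse3_eqI:
  assumes "is_inverse3 t u"
  shows "inverse3 t = u"
  unfolding inverse3_def
proof (rule the_equality)
  fix v assume "is_inverse3 t v"
  then have "v = v \<odot>\<^sub>3 (t \<odot>\<^sub>3 u)" "v \<odot>\<^sub>3 t = tens3 1 1 1"
    using assms by (simp_all add: is_inverse3_def mult3_one)
  then show "v = u" by (simp add: mult3_assoc[symmetric] mult3_one)
qed fact

lemma inverse2_eqI:
  assumes "is_inverse2 t u"
  shows "inverse2 t = u"
  unfolding inverse2_def
proof (rule the_equality)
  fix v assume "is_inverse2 t v"
  then have "v = v \<odot>\<^sub>2 (t \<odot>\<^sub>2 u)" "v \<odot>\<^sub>2 t = tens2 1 1"
    using assms by (simp_all add: is_inverse2_def mult2_one)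
  then show "v = u" by (simp add: mult2_assoc[symmetric] mult2_one)
qed fact

text \<open>Left multiplication by \<open>t\<close> is injective, being undone by left
  multiplication by \<open>u\<close>, and hence surjective in finite dimension. This yields a right
  inverse, which must agree with \<open>u\<close>.\<close>

lemma is_inverse2_if_left_inverse:
  assumes "u \<odot>\<^sub>2 t = tens2 1 1"
  shows "is_inverse2 t u"
proof -
  have l: "Vector_Spaces.linear (*s) (*s) (\<lambda>x. t \<odot>\<^sub>2 x)"
    by (intro linear_mult2 linear_identity vec.vector_space_axioms)
  have "inj (\<lambda>x. t \<odot>\<^sub>2 x)"
    by (rule inj_on_inverseI[where g = "\<lambda>x. u \<odot>\<^sub>2 x"])
      (simp add: mult2_assoc[symmetric] assms mult2_one)
  then have "surj (\<lambda>x. t \<odot>\<^sub>2 x)"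
    using vec.linear_injective_imp_surjective[OF l] by simp
  then obtain v where v: "t \<odot>\<^sub>2 v = tens2 1 1" by (metis surjD)
  have "u = u \<odot>\<^sub>2 (t \<odot>\<^sub>2 v)" by (simp add: v mult2_one)
  also have "\<dots> = v" by (simp add: mult2_assoc[symmetric] assms mult2_one)
  finally show ?thesis using assms v by (simp add: is_inverse2_def)
qed

lemma linear_inv:
  assumes "Vector_Spaces.linear scale scale f" "bij f"
  shows "Vector_Spaces.linear scale scale (inv f)"
proof -
  interpret Vector_Spaces.linear scale scale f by fact
  have *: "f (inv f x) = x" "inv f (f x) = x" for x
    using assms(2) by (simp_all add: bij_is_surj surj_f_inv_f bij_is_inj)
  show ?thesis
  proof (intro linearI vector_space_axioms)
    fix x y c
    have "inv f (f (inv f x + inv f y)) = inv f (x + y)" by (simp only: add *)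
    then show "inv f (x + y) = inv f x + inv f y" by (simp only: *)
    have "inv f (f (c \<cdot> inv f x)) = inv f (c \<cdot> x)" by (simp only: scale *)
    then show "inv f (c \<cdot> x) = c \<cdot> inv f x" by (simp only: *)
  qed
qed

lemma lift2_lift4_commute:
  assumes "vector_space s"
  shows "lift2 s (\<lambda>x y. lift4 s (F x y) u) t =
      lift4 s (\<lambda>x' y' z' w'. lift2 s (\<lambda>x y. F x y x' y' z' w') t) u"
proof -
  interpret W: vector_space s by fact
  show ?thesis
    unfolding lift_sum W.scale_sum_right by (subst sum.swap) (simp add: mult.commute)
qed

lemma lift_scale:
  assumes "vector_space s"
  shows "lift2 s (\<lambda>x y. s c (F2 x y)) t2 = s c (lift2 s F2 t2)"
    and "lift3 s (\<lambda>x y z. s c (F3 x y z)) t3 = s c (lift3 s F3 t3)"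
    and "lift4 s (\<lambda>x y z w. s c (F4 x y z w)) t4 = s c (lift4 s F4 t4)"
    and "lift2 s F2 (c *s t2) = s c (lift2 s F2 t2)"
proof -
  interpret W: vector_space s by fact
  show "lift2 s (\<lambda>x y. s c (F2 x y)) t2 = s c (lift2 s F2 t2)"
    and "lift3 s (\<lambda>x y z. s c (F3 x y z)) t3 = s c (lift3 s F3 t3)"
    and "lift4 s (\<lambda>x y z w. s c (F4 x y z w)) t4 = s c (lift4 s F4 t4)"
    and "lift2 s F2 (c *s t2) = s c (lift2 s F2 t2)"
    by (simp_all add: lift_sum W.scale_sum_right mult.commute)
qed

lemma mult2_scale: "(c *s t) \<odot>\<^sub>2 u = c *s (t \<odot>\<^sub>2 u)" "t \<odot>\<^sub>2 (c *s u) = c *s (t \<odot>\<^sub>2 u)"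
  using linear_mult2[OF linear_identity[OF vec.vector_space_axioms]]
  by (simp_all add: Vector_Spaces.linear_iff)

lemma mult2_push:
  "lift2 (*s) F2 t2 \<odot>\<^sub>2 u = lift2 (*s) (\<lambda>x y. F2 x y \<odot>\<^sub>2 u) t2"
  "lift3 (*s) F3 t3 \<odot>\<^sub>2 u = lift3 (*s) (\<lambda>x y z. F3 x y z \<odot>\<^sub>2 u) t3"
  "u \<odot>\<^sub>2 lift2 (*s) F2 t2 = lift2 (*s) (\<lambda>x y. u \<odot>\<^sub>2 F2 x y) t2"
  "u \<odot>\<^sub>2 lift3 (*s) F3 t3 = lift3 (*s) (\<lambda>x y z. u \<odot>\<^sub>2 F3 x y z) t3"
  using linear_mult2[OF linear_identity[OF vec.vector_space_axioms]]
  by (auto intro: lift2_apply lift3_apply)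

lemma mult2_tens2_lift:
  "t \<odot>\<^sub>2 tens2 u v = lift2 (*s) (\<lambda>x y. tens2 (x * u) (y * v)) t"
  "tens2 u v \<odot>\<^sub>2 t = lift2 (*s) (\<lambda>x y. tens2 (u * x) (v * y)) t"
  unfolding mult2_def by (subst lift2_tens2_bilin, intro linear_intros, rule refl)+

lemma tens2_mult2_assoc: "tens2 x y \<odot>\<^sub>2 (tens2 x' y' \<odot>\<^sub>2 t) = tens2 (x * x') (y * y') \<odot>\<^sub>2 t"
  by (simp only: mult2_assoc[symmetric] mult2_tens2)

section \<open>Traces and dual bases\<close>

lemma trace_commute:
  assumes "Vector_Spaces.linear scale scale f" "Vector_Spaces.linear scale scale g"
  shows "(\<Sum>i\<in>UNIV. dual_basis i (f (g (b i)))) = (\<Sum>i\<in>UNIV. dual_basis i (g (f (b i))))"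
proof -
  have *: "(\<Sum>i\<in>UNIV. dual_basis i (f (g (b i)))) =
      (\<Sum>i\<in>UNIV. \<Sum>j\<in>UNIV. dual_basis j (g (b i)) * dual_basis i (f (b j)))"
    if "Vector_Spaces.linear scale scale f" for f g
    using linear_sum_dual_basis[OF linear_comp[OF linear_dual_basis that]] by simp
  show ?thesis
    unfolding *[OF assms(1)] *[OF assms(2)] by (subst sum.swap) (simp add: mult.commute)
qed

text \<open>Cycling \<open>g\<close> to the inner end of the composite brings it next to
  \<open>h\<close>, where the two cancel.\<close>

lemma trace_conjugate:
  assumes "Vector_Spaces.linear scale scale f" "Vector_Spaces.linear scale scale g"
    "Vector_Spaces.linear scale scale h" and "\<And>x. h (g x) = x"
  shows "(\<Sum>i\<in>UNIV. dual_basis i (g (f (h (b i))))) = (\<Sum>i\<in>UNIV. dual_basis i (f (b i)))"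
  using trace_commute[of g "\<lambda>x. f (h x)"] assms(2) linear_comp[OF assms(1,3)] by
  (simp add: assms(4))

text \<open>Invariance of the canonical element of H \<otimes> H*, the sum of all basis vectors
  tensored with their dual functionals: composing the functionals with \<open>w\<close> amounts to
  applying \<open>w\<close> to the basis vectors.\<close>

lemma sum_dual_basis_move:
  assumes H: "Vector_Spaces.linear scale (*s) H" and w: "Vector_Spaces.linear scale scale w"
  shows "(\<Sum>i\<in>UNIV. lift2 scale (\<lambda>x y. dual_basis i (w (g y)) \<cdot> x) (H (b i))) =
    (\<Sum>i\<in>UNIV. lift2 scale (\<lambda>x y. dual_basis i (g y) \<cdot> x) (H (w (b i))))"
proof -
  interpret H: Vector_Spaces.linear scale "(*s)" H by fact
  have 1: "dual_basis i (w (g y)) = (\<Sum>j\<in>UNIV. dual_basis j (g y) * dual_basis i (w (b j)))" for i y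
    using linear_sum_dual_basis[OF linear_comp[OF linear_dual_basis w]] by simp
  have 2: "H (w (b j)) = (\<Sum>i\<in>UNIV. dual_basis i (w (b j)) *s H (b i))" for j
    using linear_sum_dual_basis[OF H] by simp
  let ?K = "\<lambda>j i. lift2 scale (\<lambda>x y. dual_basis j (g y) \<cdot> x) (H (b i))"
  have 3: "lift2 scale (\<lambda>x y. dual_basis i (w (g y)) \<cdot> x) (H (b i)) =
      (\<Sum>j\<in>UNIV. dual_basis i (w (b j)) \<cdot> ?K j i)" for i
    unfolding lift2_sum 1 scale_sum_left scale_sum_right by (subst sum.swap) (simp add: mult_ac)
  have 4: "lift2 scale (\<lambda>x y. dual_basis j (g y) \<cdot> x) (H (w (b j))) =
      (\<Sum>i\<in>UNIV. dual_basis i (w (b j)) \<cdot> ?K j i)" for j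
  proof -
    interpret L: Vector_Spaces.linear "(*s)" scale "lift2 scale (\<lambda>x y. dual_basis j (g y) \<cdot> x)"
      by (rule linear_lift2_tensor[OF vector_space_axioms linear_identity[OF
          vec.vector_space_axioms]])
    show ?thesis by (simp add: 2 L.sum L.scale)
  qed
  show ?thesis unfolding 3 4 by (rule sum.swap)
qed

section \<open>Left ideals, and semisimplicity of separable algebras\<close>

lemma left_ideal_scale:
  assumes "left_ideal I" "x \<in> I"
  shows "c \<cdot> x \<in> I"
proof -
  have "(c \<cdot> 1) * x \<in> I" using assms by (simp add: left_ideal_def)
  then show ?thesis by (simp add: scale_mult_left)
qed

lemma left_ideal_lift2:
  assumes "left_ideal I" "\<And>x y. F x y \<in> I"
  shows "lift2 scale F t \<in> I"
proof -
  have "(\<Sum>p\<in>A. t $ p \<cdot> F (b (fst p)) (b (snd p))) \<in> I" if "finite A" for A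
    using that by induction (use assms left_ideal_scale in \<open>auto simp: left_ideal_def\<close>)
  then show ?thesis by (simp add: lift2_sum)
qed

text \<open>As in Maschke's theorem, averaging a linear projection onto \<open>I\<close> over the
  separability idempotent makes it a module map; its kernel is then a complementary left
  ideal.\<close>

lemma separable_imp_semisimple:
  assumes "separable_algebra"
  shows "semisimple_ring TYPE('a)"
  unfolding semisimple_ring_def
proof (intro allI impI)
  fix I :: "'a set" assume I: "left_ideal I"
  obtain \<sigma> where \<sigma>: "\<And>a x c. \<sigma> (a * x * c) = tens2 a 1 \<odot>\<^sub>2 \<sigma> x \<odot>\<^sub>2 tens2 1 c"
    "\<And>x. lift2 scale (*) (\<sigma> x) = x"
    using assms unfolding separable_algebra_def by blast
  \<comment> \<open>The image of 1 under the splitting is the separability idempotent. Computing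
    \<open>\<sigma> a\<close> with \<open>a\<close> on the left and with \<open>a\<close> on the
    right shows that \<open>e\<close> intertwines the outer actions.\<close>
  define e where "e = \<sigma> 1"
  have e: "tens2 a 1 \<odot>\<^sub>2 e = e \<odot>\<^sub>2 tens2 1 a" for a
    using \<sigma>(1)[of a 1 1] \<sigma>(1)[of 1 1 a] by (simp add: e_def mult2_one)
  have "subspace I"
    using I by (intro subspaceI left_ideal_scale) (auto simp: left_ideal_def)
  interpret vp: vector_space_pair scale scale by unfold_locales
  obtain p where p: "range p \<subseteq> I" "Vector_Spaces.linear scale scale p" "\<And>x. x \<in> I \<Longrightarrow> p x = x"
    using vp.linear_exists_left_inverse_on[OF linear_identity[OF vector_space_axioms] \<open>subspace I\<close>]
    by auto
  define \<pi> where "\<pi> x = lift2 scale (\<lambda>u v. u * p (v * x)) e" for x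
  have lin_\<pi>: "Vector_Spaces.linear scale scale \<pi>"
    unfolding \<pi>_def by (intro linear_intros linear_comp[OF p(2)])
  \<comment> \<open>The factor \<open>a\<close> enters through the second leg of \<open>e\<close>
    and leaves through the first.\<close>
  have \<pi>_mult: "\<pi> (a * x) = a * \<pi> x" for a x
  proof -
    have b: "bilin scale (\<lambda>u v. u * p (v * x))" by (intro linear_intros linear_comp[OF p(2)])
    have b1: "bilin scale (\<lambda>u' v'. (u * u') * p (v * v' * x))" for u v
      by (intro linear_intros linear_comp[OF p(2)])
    have b2: "bilin scale (\<lambda>u v. lift2 scale (\<lambda>u' v'. (u * u') * p (v * v' * x)) t)" for t
      by (intro linear_intros linear_comp[OF p(2)])
    have "\<pi> (a * x) = lift2 scale (\<lambda>u v. u * p (v * x)) (e \<odot>\<^sub>2 tens2 1 a)"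
      unfolding lift2_mult2[OF b] lift2_tens2_bilin[OF b1] \<pi>_def by (simp add: mult.assoc)
    also have "\<dots> = lift2 scale (\<lambda>u v. u * p (v * x)) (tens2 a 1 \<odot>\<^sub>2 e)"
      by (simp only: e)
    also have "\<dots> = lift2 scale (\<lambda>u v. a * (u * p (v * x))) e"
      unfolding lift2_mult2[OF b] lift2_tens2_bilin[OF b2] by (simp add: mult.assoc)
    also have "\<dots> = a * \<pi> x"
      unfolding \<pi>_def
      by (rule lift2_apply[symmetric]) (intro linear_intros)
    finally show ?thesis .
  qed
  have \<pi>_in: "\<pi> x \<in> I" for x
    unfolding \<pi>_def
    by (rule left_ideal_lift2[OF I])
        (use I rangeI[of p, THEN subsetD[OF p(1)]] in \<open>simp add: left_ideal_def\<close>)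
  \<comment> \<open>On \<open>I\<close> the projection \<open>p\<close> fixes every
    \<open>v * x\<close>, so the legs of \<open>e\<close> are simply multiplied together, which
    gives 1.\<close>
  have \<pi>_id: "\<pi> x = x" if "x \<in> I" for x
  proof -
    have "v * x \<in> I" for v using I that by (simp add: left_ideal_def)
    then have "\<pi> x = lift2 scale (\<lambda>u v. (u * v) * x) e" by (simp add: \<pi>_def p(3) mult.assoc)
    also have "\<dots> = lift2 scale (*) e * x"
      by (rule lift2_apply[symmetric]) (intro linear_intros)
    finally show ?thesis by (simp add: e_def \<sigma>(2))
  qed
  interpret \<pi>: Vector_Spaces.linear scale scale \<pi> by (fact lin_\<pi>)
  show "\<exists>J. left_ideal J \<and> I \<inter> J = {0} \<and> (\<forall>x. \<exists>y\<in>I. \<exists>z\<in>J. x = y + z)"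
  proof (intro exI[of _ "{x. \<pi> x = 0}"] conjI allI)
    show "left_ideal {x. \<pi> x = 0}" by (simp add: left_ideal_def \<pi>.add \<pi>_mult)
    show "I \<inter> {x. \<pi> x = 0} = {0}" using \<pi>_id I by (auto simp: left_ideal_def)
    show "\<exists>y\<in>I. \<exists>z\<in>{x. \<pi> x = 0}. x = y + z" for x
      by (rule bexI[OF _ \<pi>_in[of x]], rule bexI[of _ "x - \<pi> x"]) (simp_all add: \<pi>.diff \<pi>_id \<pi>_in)
  qed
qed

end

section \<open>Quasi-bialgebras\<close>

context quasi_bialgebra
begin

abbreviation \<psi> where "\<psi> \<equiv> inverse3 \<phi>"

lemma reassociator_inverse: "\<phi> \<odot>\<^sub>3 \<psi> = tens3 1 1 1" "\<psi> \<odot>\<^sub>3 \<phi> = tens3 1 1 1"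
  using reassociator_invertible inverse3_eqI by (auto simp: is_inverse3_def)

lemmas linear_bialgebra_intros = linear_intros linear_mult2 linear_mult3 linear_mult4
  linear_comp[OF linear_comult] linear_comp[OF linear_counit]

lemma lift2_comult_mult:
  assumes "bilin s F"
  shows "lift2 s F (\<Delta> (x * y)) =
    lift2 s (\<lambda>x1 x2. lift2 s (\<lambda>y1 y2. F (x1 * y1) (x2 * y2)) (\<Delta> y)) (\<Delta> x)"
  by (simp only: comult_mult lift2_mult2[OF assms])

lemma lift2_counit:
  assumes "lin G s"
  shows "lift2 s (\<lambda>x y. s (\<epsilon> x) (G y)) (\<Delta> a) = G a"
    and "lift2 s (\<lambda>x y. s (\<epsilon> y) (G x)) (\<Delta> a) = G a"
proof -
  interpret Vector_Spaces.linear scale s G by fact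
  show "lift2 s (\<lambda>x y. s (\<epsilon> x) (G y)) (\<Delta> a) = G a"
    using lift2_apply[OF assms, of "\<lambda>x y. \<epsilon> x \<cdot> y" "\<Delta> a"] by (simp add: counit_left scale)
  show "lift2 s (\<lambda>x y. s (\<epsilon> y) (G x)) (\<Delta> a) = G a"
    using lift2_apply[OF assms, of "\<lambda>x y. \<epsilon> y \<cdot> x" "\<Delta> a"] by (simp add: counit_right scale)
qed

text \<open>Evaluating the tensor identity under an arbitrary trilinear \<open>F\<close> gives the
  Sweedler form of the law, in which later proofs move coproducts across \<phi>.\<close>

lemma quasi_coassoc_lift:
  assumes F: "trilin s F"
  shows "lift3 s (\<lambda>X Y Z. lift2 s (\<lambda>x y. lift2 s (\<lambda>y1 y2.
  F (x * X) (y1 * Y) (y2 * Z)) (\<Delta> y)) (\<Delta> a)) \<phi> =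
    lift3 s (\<lambda>X Y Z. lift2 s (\<lambda>x y. lift2 s (\<lambda>x1 x2. F (X * x1) (Y * x2) (Z * y)) (\<Delta> x)) (\<Delta> a)) \<phi>"
proof -
  note vs[simp] = trilinD(4)[OF F]
  note FI = linear_bialgebra_intros trilinD[OF F]
  have "lift3 s F (lift2 (*s) (\<lambda>x y. lift2 (*s) (\<lambda>y1 y2. tens3 x y1 y2) (\<Delta> y)) (\<Delta> a) \<odot>\<^sub>3 \<phi>) =
    lift3 s F (\<phi> \<odot>\<^sub>3 lift2 (*s) (\<lambda>x y. lift2 (*s) (\<lambda>x1 x2. tens3 x1 x2 y) (\<Delta> x)) (\<Delta> a))"
    by (simp only: quasi_coassoc)
  moreover have "trilin s (\<lambda>x y z. lift3 s (\<lambda>x' y' z'. F (x * x') (y * y') (z * z')) \<phi>)"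
    by (intro FI)
  moreover have "trilin s (\<lambda>x' y' z'. F (x * x') (y * y') (z * z'))" for x y z
    by (intro FI)
  ultimately show ?thesis
    by (simp add: lift3_mult3[OF F] lift_push lift3_tens3_trilin lift2_lift3_commute)
qed

lemma quasi_coassoc_inverse:
  "\<psi> \<odot>\<^sub>3 lift2 (*s) (\<lambda>x y. lift2 (*s) (\<lambda>y1 y2. tens3 x y1 y2) (\<Delta> y)) (\<Delta> a) =
    lift2 (*s) (\<lambda>x y. lift2 (*s) (\<lambda>x1 x2. tens3 x1 x2 y) (\<Delta> x)) (\<Delta> a) \<odot>\<^sub>3 \<psi>"
  (is "\<psi> \<odot>\<^sub>3 ?l = ?r \<odot>\<^sub>3 \<psi>")
proof -
  have "\<psi> \<odot>\<^sub>3 ?l = \<psi> \<odot>\<^sub>3 (?l \<odot>\<^sub>3 \<phi>) \<odot>\<^sub>3 \<psi>"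
    by (simp only: mult3_assoc reassociator_inverse mult3_one)
  also have "\<dots> = (\<psi> \<odot>\<^sub>3 \<phi>) \<odot>\<^sub>3 ?r \<odot>\<^sub>3 \<psi>" by (simp only: quasi_coassoc mult3_assoc)
  finally show ?thesis by (simp only: reassociator_inverse mult3_one)
qed

lemma quasi_coassoc_inverse_lift:
  assumes F: "trilin s F"
  shows "lift3 s (\<lambda>X Y Z. lift2 s (\<lambda>x y. lift2 s (\<lambda>y1 y2.
  F (X * x) (Y * y1) (Z * y2)) (\<Delta> y)) (\<Delta> a)) \<psi> =
    lift3 s (\<lambda>X Y Z. lift2 s (\<lambda>x y. lift2 s (\<lambda>x1 x2. F (x1 * X) (x2 * Y) (y * Z)) (\<Delta> x)) (\<Delta> a)) \<psi>"
proof -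
  note vs[simp] = trilinD(4)[OF F]
  note FI = linear_bialgebra_intros trilinD[OF F]
  have "lift3 s F (\<psi> \<odot>\<^sub>3 lift2 (*s) (\<lambda>x y. lift2 (*s) (\<lambda>y1 y2. tens3 x y1 y2) (\<Delta> y)) (\<Delta> a)) =
    lift3 s F (lift2 (*s) (\<lambda>x y. lift2 (*s) (\<lambda>x1 x2. tens3 x1 x2 y) (\<Delta> x)) (\<Delta> a) \<odot>\<^sub>3 \<psi>)"
    by (simp only: quasi_coassoc_inverse)
  moreover have "trilin s (\<lambda>x y z. lift3 s (\<lambda>x' y' z'. F (x * x') (y * y') (z * z')) \<psi>)"
    by (intro FI)
  moreover have "trilin s (\<lambda>x' y' z'. F (x * x') (y * y') (z * z'))" for x y z
    by (intro FI)
  ultimately show ?thesis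
    by (simp add: lift3_mult3[OF F] lift_push lift3_tens3_trilin lift2_lift3_commute)
qed

section \<open>The pentagon in the fourth tensor power\<close>

definition comult1 :: "('k, 'i \<times> 'i \<times> 'i) vec \<Rightarrow> ('k, 'i \<times> 'i \<times> 'i \<times> 'i) vec" where
  "comult1 = lift3 (*s) (\<lambda>x y z. lift2 (*s) (\<lambda>x1 x2. tens4 x1 x2 y z) (\<Delta> x))"

definition comult2 :: "('k, 'i \<times> 'i \<times> 'i) vec \<Rightarrow> ('k, 'i \<times> 'i \<times> 'i \<times> 'i) vec" where
  "comult2 = lift3 (*s) (\<lambda>x y z. lift2 (*s) (\<lambda>y1 y2. tens4 x y1 y2 z) (\<Delta> y))"

definition comult3 :: "('k, 'i \<times> 'i \<times> 'i) vec \<Rightarrow> ('k, 'i \<times> 'i \<times> 'i \<times> 'i) vec" where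
  "comult3 = lift3 (*s) (\<lambda>x y z. lift2 (*s) (\<lambda>z1 z2. tens4 x y z1 z2) (\<Delta> z))"

definition unit_left :: "('k, 'i \<times> 'i \<times> 'i) vec \<Rightarrow> ('k, 'i \<times> 'i \<times> 'i \<times> 'i) vec" where
  "unit_left = lift3 (*s) (\<lambda>x y z. tens4 1 x y z)"

definition unit_right :: "('k, 'i \<times> 'i \<times> 'i) vec \<Rightarrow> ('k, 'i \<times> 'i \<times> 'i \<times> 'i) vec" where
  "unit_right = lift3 (*s) (\<lambda>x y z. tens4 x y z 1)"

lemmas slot_defs = comult1_def comult2_def comult3_def unit_left_def unit_right_def

lemma pentagon_slots:
  "comult3 \<phi> \<odot>\<^sub>4 comult1 \<phi> = unit_left \<phi> \<odot>\<^sub>4 comult2 \<phi> \<odot>\<^sub>4 unit_right \<phi>"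
  unfolding slot_defs by (rule pentagon)

text \<open>All five slot maps are algebra homomorphisms because \<Delta> is one. Hence images of
  \<phi> under them are invertible, and the pentagon can be solved for a chosen product.\<close>

lemma slot_mult:
  "comult1 (t \<odot>\<^sub>3 u) = comult1 t \<odot>\<^sub>4 comult1 u"
  "comult2 (t \<odot>\<^sub>3 u) = comult2 t \<odot>\<^sub>4 comult2 u"
  "comult3 (t \<odot>\<^sub>3 u) = comult3 t \<odot>\<^sub>4 comult3 u"
  "unit_left (t \<odot>\<^sub>3 u) = unit_left t \<odot>\<^sub>4 unit_left u"
  "unit_right (t \<odot>\<^sub>3 u) = unit_right t \<odot>\<^sub>4 unit_right u"
proof -
  note m1 = lift2_apply[OF linear_mult4(1)[OF linear_identity[OF vec.vector_space_axioms]]]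
  note m2 = lift2_apply[OF linear_mult4(2)[OF linear_identity[OF vec.vector_space_axioms]]]
      mult4_tens4
  have b: "bilin (*s) (\<lambda>x y. tens4 x y z w)" "bilin (*s) (\<lambda>x y. tens4 z x y w)"
    "bilin (*s) (\<lambda>x y. tens4 z w x y)" for z w
    by (intro linear_bialgebra_intros)+
  show "comult1 (t \<odot>\<^sub>3 u) = comult1 t \<odot>\<^sub>4 comult1 u"
    unfolding slot_defs
    by (rule lift3_mult4_hom, intro linear_bialgebra_intros, simp only: lift2_comult_mult[OF
        b(1)] m1,
        simp only: m2)
  show "comult2 (t \<odot>\<^sub>3 u) = comult2 t \<odot>\<^sub>4 comult2 u"
    unfolding slot_defs
    by (rule lift3_mult4_hom, intro linear_bialgebra_intros, simp only: lift2_comult_mult[OF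
        b(2)] m1,
        simp only: m2)
  show "comult3 (t \<odot>\<^sub>3 u) = comult3 t \<odot>\<^sub>4 comult3 u"
    unfolding slot_defs
    by (rule lift3_mult4_hom, intro linear_bialgebra_intros, simp only: lift2_comult_mult[OF
        b(3)] m1,
        simp only: m2)
  show "unit_left (t \<odot>\<^sub>3 u) = unit_left t \<odot>\<^sub>4 unit_left u"
    unfolding slot_defs by (rule lift3_mult4_hom, intro linear_bialgebra_intros, simp add:
        mult4_tens4)
  show "unit_right (t \<odot>\<^sub>3 u) = unit_right t \<odot>\<^sub>4 unit_right u"
    unfolding slot_defs by (rule lift3_mult4_hom, intro linear_bialgebra_intros, simp add:
        mult4_tens4)
qed

lemma slot_one:
  "comult1 (tens3 1 1 1) = tens4 1 1 1 1" "comult2 (tens3 1 1 1) = tens4 1 1 1 1"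
  "comult3 (tens3 1 1 1) = tens4 1 1 1 1" "unit_left (tens3 1 1 1) = tens4 1 1 1 1"
  "unit_right (tens3 1 1 1) = tens4 1 1 1 1"
  unfolding slot_defs
  by (subst lift3_tens3_trilin, intro linear_bialgebra_intros,
      (simp only: comult_one, subst lift2_tens2_bilin, intro linear_bialgebra_intros)?, rule refl)+

lemma slot_inverse:
  "comult1 \<phi> \<odot>\<^sub>4 comult1 \<psi> = tens4 1 1 1 1" "comult1 \<psi> \<odot>\<^sub>4 comult1 \<phi> = tens4 1 1 1 1"
  "comult3 \<phi> \<odot>\<^sub>4 comult3 \<psi> = tens4 1 1 1 1" "comult3 \<psi> \<odot>\<^sub>4 comult3 \<phi> = tens4 1 1 1 1"
  "unit_left \<phi> \<odot>\<^sub>4 unit_left \<psi> = tens4 1 1 1 1" "unit_left \<psi> \<odot>\<^sub>4 unit_left \<phi> = tens4 1 1 1 1"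
  "unit_right \<phi> \<odot>\<^sub>4 unit_right \<psi> = tens4 1 1 1 1" "unit_right \<psi> \<odot>\<^sub>4 unit_right \<phi> = tens4 1 1 1 1"
  by (simp_all only: slot_mult[symmetric] reassociator_inverse slot_one)

text \<open>In this solution of the pentagon \<open>comult3 \<psi>\<close> and
  \<open>comult2 \<phi>\<close> stand at the outer ends, where antipode identities can absorb them
  so that \<open>unit_left \<phi>\<close> survives.\<close>

lemma pentagon_unit_right:
  "comult1 \<phi> \<odot>\<^sub>4 unit_right \<psi> = comult3 \<psi> \<odot>\<^sub>4 (unit_left \<phi> \<odot>\<^sub>4 comult2 \<phi>)"
proof -
  have "comult1 \<phi> \<odot>\<^sub>4 unit_right \<psi> = comult3 \<psi> \<odot>\<^sub>4 (comult3 \<phi> \<odot>\<^sub>4 comult1 \<phi>) \<odot>\<^sub>4 unit_right \<psi>"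
    by (simp only: mult4_assoc[symmetric] slot_inverse mult4_one)
  also have "\<dots> = comult3 \<psi> \<odot>\<^sub>4 (unit_left \<phi> \<odot>\<^sub>4 comult2 \<phi>) \<odot>\<^sub>4 (unit_right \<phi> \<odot>\<^sub>4 unit_right \<psi>)"
    by (simp only: pentagon_slots mult4_assoc)
  finally show ?thesis by (simp only: slot_inverse mult4_one)
qed

text \<open>The mirror form: \<open>comult2 \<phi>\<close> and \<open>comult1 \<psi>\<close> stand
  at the outer ends and \<open>unit_right \<phi>\<close> is in the middle.\<close>

lemma pentagon_unit_left:
  "unit_left \<psi> \<odot>\<^sub>4 comult3 \<phi> = comult2 \<phi> \<odot>\<^sub>4 unit_right \<phi> \<odot>\<^sub>4 comult1 \<psi>"
proof -
  have "unit_left \<psi> \<odot>\<^sub>4 comult3 \<phi> = unit_left \<psi> \<odot>\<^sub>4 (comult3 \<phi> \<odot>\<^sub>4 comult1 \<phi>) \<odot>\<^sub>4 comult1 \<psi>"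
    by (simp only: mult4_assoc slot_inverse mult4_one)
  also have "\<dots> = (unit_left \<psi> \<odot>\<^sub>4 unit_left \<phi>) \<odot>\<^sub>4 comult2 \<phi> \<odot>\<^sub>4 unit_right \<phi> \<odot>\<^sub>4 comult1 \<psi>"
    by (simp only: pentagon_slots mult4_assoc)
  finally show ?thesis by (simp only: slot_inverse mult4_one)
qed

text \<open>The axiom covers the middle slot of \<phi>. Applying counits to the first two, or to the
  last two, legs of the pentagon shows that the value at an outer slot is idempotent; being
  invertible, it is 1. Multiplicativity then gives the values at \<psi>.\<close>

lemma counit_reassociator_slots:
  defines "E1 \<equiv> lift3 (*s) (\<lambda>x y z. \<epsilon> x *s tens2 y z)"
    and "E2 \<equiv> lift3 (*s) (\<lambda>x y z. \<epsilon> y *s tens2 x z)"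
    and "E3 \<equiv> lift3 (*s) (\<lambda>x y z. \<epsilon> z *s tens2 x y)"
  shows "E1 \<phi> = tens2 1 1" "E2 \<phi> = tens2 1 1" "E3 \<phi> = tens2 1 1"
    and "E1 \<psi> = tens2 1 1" "E2 \<psi> = tens2 1 1" "E3 \<psi> = tens2 1 1"
proof -
  have mult: "E1 (t \<odot>\<^sub>3 u) = E1 t \<odot>\<^sub>2 E1 u" "E2 (t \<odot>\<^sub>3 u) = E2 t \<odot>\<^sub>2 E2 u"
    "E3 (t \<odot>\<^sub>3 u) = E3 t \<odot>\<^sub>2 E3 u" for t u
    unfolding assms
    by (rule lift3_mult2_hom, intro linear_bialgebra_intros,
        simp add: counit_mult mult2_tens2 mult2_scale)+
  have one: "E1 (tens3 1 1 1) = tens2 1 1" "E2 (tens3 1 1 1) = tens2 1 1"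
    "E3 (tens3 1 1 1) = tens2 1 1"
    unfolding assms by (subst lift3_tens3_trilin, intro linear_bialgebra_intros, simp add:
        counit_one)+
  have E2: "E2 \<phi> = tens2 1 1" unfolding assms by (rule counit_reassociator)
  have E2_lift: "lift3 (*s) (\<lambda>x y z. \<epsilon> y *s G x z) \<phi> = (G 1 1 :: ('k, 'i \<times> 'i) vec)"
    if "bilin (*s) G" for G
    using arg_cong[OF E2, of "lift2 (*s) G"] unfolding assms
    by (simp add: lift_push[OF vec.vector_space_axioms] lift2_tens2_bilin[OF that] lift_scale[OF
        vec.vector_space_axioms])
  have E2_inv: "E2 \<psi> = tens2 1 1"
    using mult(2)[of \<phi> \<psi>] by (simp add: reassociator_inverse E2 one mult2_one)
  have idem: "t = tens2 1 1" if "t = t \<odot>\<^sub>2 t" "t \<odot>\<^sub>2 u = tens2 1 1" for t u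
  proof -
    have "tens2 1 1 = t \<odot>\<^sub>2 t \<odot>\<^sub>2 u" using that by simp
    then show ?thesis using that(2) by (simp add: mult2_assoc mult2_one)
  qed
  note vs = vec.vector_space_axioms
  note scalars = vec.scale_left_commute[of _ _ "_ :: ('k, 'i \<times> 'i) vec"]
  have M: "quadlin (*s) (\<lambda>x y z w. \<epsilon> x *s (\<epsilon> y *s tens2 z w))"
    "quadlin (*s) (\<lambda>x y z w. \<epsilon> z *s (\<epsilon> w *s tens2 x y))"
    by (intro linear_bialgebra_intros)+
  let ?M = "lift4 (*s) (\<lambda>x y z w. \<epsilon> x *s (\<epsilon> y *s tens2 z w))"
  let ?M' = "lift4 (*s) (\<lambda>x y z w. \<epsilon> z *s (\<epsilon> w *s tens2 x y))"
  have M_mult: "?M (t \<odot>\<^sub>4 u) = ?M t \<odot>\<^sub>2 ?M u" "?M' (t \<odot>\<^sub>4 u) = ?M' t \<odot>\<^sub>2 ?M' u" for t u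
    by (rule lift4_mult2_hom, intro linear_bialgebra_intros,
      simp add: counit_mult mult2_tens2 mult2_scale mult_ac)+
  have c: "lift2 (*s) (\<lambda>x1 x2. \<epsilon> x1 *s (\<epsilon> x2 *s w)) (\<Delta> x) = \<epsilon> x *s w"
    "lift2 (*s) (\<lambda>x1 x2. \<epsilon> x1 *s tens2 x2 y) (\<Delta> x) = tens2 x y"
    "lift2 (*s) (\<lambda>x1 x2. \<epsilon> x2 *s tens2 y x1) (\<Delta> x) = tens2 y x"
    "lift2 (*s) (\<lambda>x1 x2. \<epsilon> x2 *s (k *s tens2 y x1)) (\<Delta> x) = k *s tens2 y x"
    for k x y and w :: "('k, 'i \<times> 'i) vec"
    by (rule lift2_counit, intro linear_bialgebra_intros)+
  have 1: "?M (comult1 t) = E1 t" "?M (comult2 t) = E1 t" "?M (unit_left t) = E1 t"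
    "?M' (comult3 t) = E3 t" "?M' (comult2 t) = E3 t" "?M' (unit_right t) = E3 t" for t
    unfolding slot_defs assms
    by (simp_all only: lift_push[OF vs] lift4_tens4_quadlin[OF M(1)] lift4_tens4_quadlin[OF
        M(2)] c lift_scale[OF vs]
        counit_one vec.scale_one)
  \<comment> \<open>In each of these terms a counit falls on the middle factor of \<phi>, so the
    axiom applies and reduces the outer factors to 1.\<close>
  have 2: "?M (comult3 \<phi>) = tens2 1 1" "?M' (comult1 \<phi>) = tens2 1 1"
    "?M (unit_right \<phi>) = tens2 1 1" "?M' (unit_left \<phi>) = tens2 1 1"
  proof -
    have "?M (comult3 \<phi>) = lift3 (*s) (\<lambda>x y z. \<epsilon> y *s (\<epsilon> x *s \<Delta> z)) \<phi>"
      unfolding slot_defs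
      by (simp only: lift_push[OF vs] lift4_tens4_quadlin[OF M(1)] lift_scale[OF vs]
          lift2_tens2_self scalars)
    also have "\<dots> = tens2 1 1"
      by (subst E2_lift, intro linear_bialgebra_intros, simp add: counit_one comult_one)
    finally show "?M (comult3 \<phi>) = tens2 1 1" .
    have "?M' (comult1 \<phi>) = lift3 (*s) (\<lambda>x y z. \<epsilon> y *s (\<epsilon> z *s \<Delta> x)) \<phi>"
      unfolding slot_defs
      by (simp only: lift_push[OF vs] lift4_tens4_quadlin[OF M(2)] lift_scale[OF vs]
          lift2_tens2_self)
    also have "\<dots> = tens2 1 1"
      by (subst E2_lift, intro linear_bialgebra_intros, simp add: counit_one comult_one)
    finally show "?M' (comult1 \<phi>) = tens2 1 1" .
    have "?M (unit_right \<phi>) = lift3 (*s) (\<lambda>x y z. \<epsilon> y *s (\<epsilon> x *s tens2 z 1)) \<phi>"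
      unfolding slot_defs by (simp only: lift_push[OF vs] lift4_tens4_quadlin[OF M(1)] scalars)
    also have "\<dots> = tens2 1 1"
      by (subst E2_lift, intro linear_bialgebra_intros, simp add: counit_one)
    finally show "?M (unit_right \<phi>) = tens2 1 1" .
    have "?M' (unit_left \<phi>) = lift3 (*s) (\<lambda>x y z. \<epsilon> y *s (\<epsilon> z *s tens2 1 x)) \<phi>"
      unfolding slot_defs by (simp only: lift_push[OF vs] lift4_tens4_quadlin[OF M(2)])
    also have "\<dots> = tens2 1 1"
      by (subst E2_lift, intro linear_bialgebra_intros, simp add: counit_one)
    finally show "?M' (unit_left \<phi>) = tens2 1 1" .
  qed
  have inv: "E1 \<phi> \<odot>\<^sub>2 E1 \<psi> = tens2 1 1" "E3 \<phi> \<odot>\<^sub>2 E3 \<psi> = tens2 1 1"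
    by (simp_all only: mult[symmetric] reassociator_inverse one)
  have "E1 \<phi> = E1 \<phi> \<odot>\<^sub>2 E1 \<phi>"
    using arg_cong[OF pentagon_slots, of ?M] by (simp only: M_mult 1 2 mult2_one)
  then show E1: "E1 \<phi> = tens2 1 1" using inv(1) by (rule idem)
  have "E3 \<phi> = E3 \<phi> \<odot>\<^sub>2 E3 \<phi>"
    using arg_cong[OF pentagon_slots, of ?M'] by (simp only: M_mult 1 2 mult2_one)
  then show E3: "E3 \<phi> = tens2 1 1" using inv(2) by (rule idem)
  show "E1 \<psi> = tens2 1 1" using inv(1) by (simp only: E1 mult2_one)
  show "E3 \<psi> = tens2 1 1" using inv(2) by (simp only: E3 mult2_one)
  show "E2 \<psi> = tens2 1 1" by (fact E2_inv)
  show "E2 \<phi> = tens2 1 1" by (fact E2)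
qed

lemma lift3_counit:
  assumes G: "bilin s G"
  shows "lift3 s (\<lambda>x y z. s (\<epsilon> x) (G y z)) \<phi> = G 1 1" "lift3 s (\<lambda>x y z. s (\<epsilon> y) (G x z)) \<phi> = G 1 1"
    "lift3 s (\<lambda>x y z. s (\<epsilon> z) (G x y)) \<phi> = G 1 1" "lift3 s (\<lambda>x y z. s (\<epsilon> x) (G y z)) \<psi> = G 1 1"
    "lift3 s (\<lambda>x y z. s (\<epsilon> y) (G x z)) \<psi> = G 1 1" "lift3 s (\<lambda>x y z. s (\<epsilon> z) (G x y)) \<psi> = G 1 1"
  using counit_reassociator_slots[THEN arg_cong[of _ _ "lift2 s G"]]
  by (simp_all only: lift_push[OF bilinD(3)[OF G]] lift2_tens2_bilin[OF G] lift_scale[OF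
      bilinD(3)[OF G]])

text \<open>A coproduct in adjacent slots that \<open>\<Phi>\<close> absorbs may be dropped from a factor
  \<open>\<phi>\<^sup>\<plusminus>\<^sup>1\<close> standing at the matching end of a product.\<close>

lemma lift4_drop_left:
  assumes \<Phi>: "quadlin s \<Phi>"
  shows "(\<And>a x y z w. lift2 s (\<lambda>a1 a2. \<Phi> (a1 * x) (a2 * y) z w) (\<Delta> a) = s (\<epsilon> a) (\<Phi> x y z w)) \<Longrightarrow>
      lift4 s \<Phi> (comult1 \<phi> \<odot>\<^sub>4 t) = lift4 s \<Phi> t"
    and "(\<And>a x y z w. lift2 s (\<lambda>a1 a2. \<Phi> x (a1 * y) (a2 * z) w) (\<Delta> a) = s (\<epsilon> a) (\<Phi> x y z w)) \<Longrightarrow>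
      lift4 s \<Phi> (comult2 \<phi> \<odot>\<^sub>4 t) = lift4 s \<Phi> t"
    and "(\<And>a x y z w. lift2 s (\<lambda>a1 a2. \<Phi> x y (a1 * z) (a2 * w)) (\<Delta> a) = s (\<epsilon> a) (\<Phi> x y z w)) \<Longrightarrow>
      lift4 s \<Phi> (comult3 \<psi> \<odot>\<^sub>4 t) = lift4 s \<Phi> t"
proof -
  note vs = quadlinD(5)[OF \<Phi>]
  note FI = linear_bialgebra_intros quadlinD[OF \<Phi>]
  have q: "quadlin s (\<lambda>x y z w. lift4 s (\<lambda>x' y' z' w'. \<Phi> (x * x') (y * y') (z * z') (w * w')) t)"
    by (intro FI)
  have b: "bilin s (\<lambda>y z. lift4 s (\<lambda>x' y' z' w'. \<Phi> x' y' (y * z') (z * w')) t)"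
    "bilin s (\<lambda>x z. lift4 s (\<lambda>x' y' z' w'. \<Phi> (x * x') y' z' (z * w')) t)"
    "bilin s (\<lambda>x y. lift4 s (\<lambda>x' y' z' w'. \<Phi> (x * x') (y * y') z' w') t)"
    by (intro FI)+
  note e = lift4_mult4[OF \<Phi>] slot_defs lift_push[OF vs] lift4_tens4_quadlin[OF q]
      lift2_lift4_commute[OF vs]
  show "lift4 s \<Phi> (comult1 \<phi> \<odot>\<^sub>4 t) = lift4 s \<Phi> t"
    if "\<And>a x y z w. lift2 s (\<lambda>a1 a2. \<Phi> (a1 * x) (a2 * y) z w) (\<Delta> a) = s (\<epsilon> a) (\<Phi> x y z w)"
    by (simp only: e that lift_scale[OF vs] lift3_counit[OF b(1)] mult_1_left)
  show "lift4 s \<Phi> (comult2 \<phi> \<odot>\<^sub>4 t) = lift4 s \<Phi> t"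
    if "\<And>a x y z w. lift2 s (\<lambda>a1 a2. \<Phi> x (a1 * y) (a2 * z) w) (\<Delta> a) = s (\<epsilon> a) (\<Phi> x y z w)"
    by (simp only: e that lift_scale[OF vs] lift3_counit[OF b(2)] mult_1_left)
  show "lift4 s \<Phi> (comult3 \<psi> \<odot>\<^sub>4 t) = lift4 s \<Phi> t"
    if "\<And>a x y z w. lift2 s (\<lambda>a1 a2. \<Phi> x y (a1 * z) (a2 * w)) (\<Delta> a) = s (\<epsilon> a) (\<Phi> x y z w)"
    by (simp only: e that lift_scale[OF vs] lift3_counit[OF b(3)] mult_1_left)
qed

lemma lift4_drop_right:
  assumes \<Phi>: "quadlin s \<Phi>"
  shows "(\<And>a x y z w. lift2 s (\<lambda>a1 a2. \<Phi> (x * a1) (y * a2) z w) (\<Delta> a) = s (\<epsilon> a) (\<Phi> x y z w)) \<Longrightarrow>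
      lift4 s \<Phi> (t \<odot>\<^sub>4 comult1 \<psi>) = lift4 s \<Phi> t"
    and "(\<And>a x y z w. lift2 s (\<lambda>a1 a2. \<Phi> x (y * a1) (z * a2) w) (\<Delta> a) = s (\<epsilon> a) (\<Phi> x y z w)) \<Longrightarrow>
      lift4 s \<Phi> (t \<odot>\<^sub>4 comult2 \<phi>) = lift4 s \<Phi> t"
proof -
  note vs = quadlinD(5)[OF \<Phi>]
  note FI = linear_bialgebra_intros quadlinD[OF \<Phi>]
  have q: "quadlin s (\<lambda>x' y' z' w'. \<Phi> (x * x') (y * y') (z * z') (w * w'))" for x y z w
    by (intro FI)
  have b: "bilin s (\<lambda>y' z'. \<Phi> x y (z * y') (w * z'))"
    "bilin s (\<lambda>x' z'. \<Phi> (x * x') y z (w * z'))" for x y z w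
    by (intro FI)+
  note e = lift4_mult4[OF \<Phi>] slot_defs lift_push[OF vs] lift4_tens4_quadlin[OF q]
  show "lift4 s \<Phi> (t \<odot>\<^sub>4 comult1 \<psi>) = lift4 s \<Phi> t"
    if "\<And>a x y z w. lift2 s (\<lambda>a1 a2. \<Phi> (x * a1) (y * a2) z w) (\<Delta> a) = s (\<epsilon> a) (\<Phi> x y z w)"
    by (simp only: e that lift3_counit[OF b(1)] mult_1_right)
  show "lift4 s \<Phi> (t \<odot>\<^sub>4 comult2 \<phi>) = lift4 s \<Phi> t"
    if "\<And>a x y z w. lift2 s (\<lambda>a1 a2. \<Phi> x (y * a1) (z * a2) w) (\<Delta> a) = s (\<epsilon> a) (\<Phi> x y z w)"
    by (simp only: e that lift3_counit[OF b(2)] mult_1_right)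
qed

text \<open>A dictionary between products of slot maps and Sweedler notation. It serves to recognize
  a concrete expression as a multilinear map evaluated on a piece of the pentagon.\<close>

lemma lift4_slots:
  assumes \<Phi>: "quadlin s \<Phi>"
  shows "lift4 s \<Phi> (comult1 \<phi> \<odot>\<^sub>4 unit_right \<psi>) = lift3 s (\<lambda>X Y Z. lift3 s (\<lambda>x y z.
      lift2 s (\<lambda>X1 X2. \<Phi> (X1 * x) (X2 * y) (Y * z) Z) (\<Delta> X)) \<psi>) \<phi>"
    and "lift4 s \<Phi> (unit_left \<psi> \<odot>\<^sub>4 comult3 \<phi>) = lift3 s (\<lambda>X Y Z. lift3 s (\<lambda>x y z.
      lift2 s (\<lambda>Z1 Z2. \<Phi> X (x * Y) (y * Z1) (z * Z2)) (\<Delta> Z)) \<psi>) \<phi>"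
    and "lift4 s \<Phi> (comult3 \<phi> \<odot>\<^sub>4 comult1 \<phi>) = lift3 s (\<lambda>X Y Z. lift3 s (\<lambda>x y z.
      lift2 s (\<lambda>x1 x2. lift2 s (\<lambda>Z1 Z2. \<Phi> (X * x1) (Y * x2) (Z1 * y) (Z2 * z)) (\<Delta> Z)) (\<Delta> x)) \<phi>) \<phi>"
    and "lift4 s \<Phi> (unit_left \<phi> \<odot>\<^sub>4 comult2 \<phi> \<odot>\<^sub>4 unit_right \<phi>) =
      lift3 s (\<lambda>x y z. lift3 s (\<lambda>X Y Z. lift3 s (\<lambda>x' y' z'. lift2 s (\<lambda>Y1 Y2.
        \<Phi> (X * x') (x * Y1 * y') (y * Y2 * z') (z * Z)) (\<Delta> Y)) \<phi>) \<phi>) \<phi>"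
    and "lift4 s \<Phi> (unit_left t) = lift3 s (\<lambda>x y z. \<Phi> 1 x y z) t"
    and "lift4 s \<Phi> (unit_right t) = lift3 s (\<lambda>x y z. \<Phi> x y z 1) t"
proof -
  note vs = quadlinD(5)[OF \<Phi>]
  note FI = linear_bialgebra_intros quadlinD[OF \<Phi>]
  have q: "quadlin s (\<lambda>x' y' z' w'. \<Phi> (x * x') (y * y') (z * z') (w * w'))" for x y z w
    by (intro FI)
  have r: "quadlin s (\<lambda>x y z w. lift3 s (\<lambda>x' y' z'. \<Phi> (x * x') (y * y') (z * z') w) t)"
    "quadlin s (\<lambda>x y z w. lift3 s (\<lambda>X Y Z. lift2 s (\<lambda>Z1 Z2.
        \<Phi> (x * X) (y * Y) (z * Z1) (w * Z2)) (\<Delta> Z)) t)"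
    "quadlin s (\<lambda>x y z w. lift3 s (\<lambda>X Y Z. lift2 s (\<lambda>X1 X2.
        \<Phi> (x * X1) (y * X2) (z * Y) (w * Z)) (\<Delta> X)) t)"
    "quadlin s (\<lambda>x y z w. lift3 s (\<lambda>X Y Z. lift3 s (\<lambda>x' y' z'. lift2 s (\<lambda>Y1 Y2.
      \<Phi> (x * X * x') (y * Y1 * y') (z * Y2 * z') (w * Z)) (\<Delta> Y)) u) t)"
    for t u by (intro FI)+
  have r': "quadlin s (\<lambda>x y z w. lift3 s (\<lambda>x' y' z'.
      \<Phi> (a * x * x') (b * y * y') (c * z * z') (d * w)) t)"
    for a b c d t by (intro FI)
  note e = lift4_mult4[OF \<Phi>] slot_defs lift_push[OF vs] lift4_tens4_quadlin[OF q]
    lift4_tens4_quadlin[OF \<Phi>] lift2_lift3_commute[OF vs] lift4_mult4[OF r(1)]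
    lift4_tens4_quadlin[OF r(1)] lift4_tens4_quadlin[OF r(2)] lift4_tens4_quadlin[OF r(3)]
        lift4_tens4_quadlin[OF r(4)]
    lift4_tens4_quadlin[OF r'] mult_1_left mult_1_right
  show "lift4 s \<Phi> (comult1 \<phi> \<odot>\<^sub>4 unit_right \<psi>) = lift3 s (\<lambda>X Y Z. lift3 s (\<lambda>x y z.
      lift2 s (\<lambda>X1 X2. \<Phi> (X1 * x) (X2 * y) (Y * z) Z) (\<Delta> X)) \<psi>) \<phi>"
    by (simp only: e)
  show "lift4 s \<Phi> (unit_left \<psi> \<odot>\<^sub>4 comult3 \<phi>) = lift3 s (\<lambda>X Y Z. lift3 s (\<lambda>x y z.
      lift2 s (\<lambda>Z1 Z2. \<Phi> X (x * Y) (y * Z1) (z * Z2)) (\<Delta> Z)) \<psi>) \<phi>"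
    by (subst lift3_lift3_commute[OF vs]) (simp only: e)
  show "lift4 s \<Phi> (comult3 \<phi> \<odot>\<^sub>4 comult1 \<phi>) = lift3 s (\<lambda>X Y Z. lift3 s (\<lambda>x y z.
      lift2 s (\<lambda>x1 x2. lift2 s (\<lambda>Z1 Z2. \<Phi> (X * x1) (Y * x2) (Z1 * y) (Z2 * z)) (\<Delta> Z)) (\<Delta> x)) \<phi>) \<phi>"
    by (subst lift2_lift2_commute[OF vs]) (simp only: e)
  show "lift4 s \<Phi> (unit_left \<phi> \<odot>\<^sub>4 comult2 \<phi> \<odot>\<^sub>4 unit_right \<phi>) =
      lift3 s (\<lambda>x y z. lift3 s (\<lambda>X Y Z. lift3 s (\<lambda>x' y' z'. lift2 s (\<lambda>Y1 Y2.
        \<Phi> (X * x') (x * Y1 * y') (y * Y2 * z') (z * Z)) (\<Delta> Y)) \<phi>) \<phi>) \<phi>"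
    by (simp only: e)
  show "lift4 s \<Phi> (unit_left t) = lift3 s (\<lambda>x y z. \<Phi> 1 x y z) t"
    "lift4 s \<Phi> (unit_right t) = lift3 s (\<lambda>x y z. \<Phi> x y z 1) t"
    by (simp_all only: e)
qed

section \<open>Integrals in a quasi-bialgebra\<close>

lemma counit_zero: "\<epsilon> 0 = 0" and counit_add: "\<epsilon> (x + y) = \<epsilon> x + \<epsilon> y"
  and counit_diff: "\<epsilon> (x - y) = \<epsilon> x - \<epsilon> y" and counit_scale: "\<epsilon> (c \<cdot> x) = c * \<epsilon> x"
proof -
  interpret Vector_Spaces.linear scale "(*)" \<epsilon> by (fact linear_counit)
  show "\<epsilon> 0 = 0" "\<epsilon> (x + y) = \<epsilon> x + \<epsilon> y" "\<epsilon> (x - y) = \<epsilon> x - \<epsilon> y" "\<epsilon> (c \<cdot> x) = c * \<epsilon> x"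
    by (simp_all add: zero add diff scale)
qed

text \<open>The integral is the component \<open>z\<close> of 1 in a complement of the augmentation
  ideal: \<open>a * z - \<epsilon> a \<cdot> z\<close> lies both in the complement and in the kernel
  of \<epsilon>, and so vanishes.\<close>

lemma semisimple_imp_left_integral:
  assumes "semisimple_ring TYPE('a)"
  shows "\<exists>l. left_integral l \<and> normalized l"
proof -
  have "left_ideal {x. \<epsilon> x = 0}"
    by (simp add: left_ideal_def counit_zero counit_add counit_mult)
  then obtain J where J: "left_ideal J" "{x. \<epsilon> x = 0} \<inter> J = {0}"
      "\<forall>x. \<exists>y\<in>{x. \<epsilon> x = 0}. \<exists>z\<in>J. x = y + z"
    using assms unfolding semisimple_ring_def by meson
  from J(3) obtain y z where yz: "\<epsilon> y = 0" "z \<in> J" "1 = y + z" by blast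
  have z: "\<epsilon> z = 1" using arg_cong[OF yz(3), of \<epsilon>] by (simp add: counit_add counit_one yz(1))
  have "a * z = \<epsilon> a \<cdot> z" for a
  proof -
    have "a * z - \<epsilon> a \<cdot> z = (a - \<epsilon> a \<cdot> 1) * z" by (simp add: left_diff_distrib scale_mult_left)
    then have "a * z - \<epsilon> a \<cdot> z \<in> J" using J(1) yz(2) by (simp add: left_ideal_def)
    moreover have "\<epsilon> (a * z - \<epsilon> a \<cdot> z) = 0" by (simp add: counit_diff counit_scale counit_mult)
    ultimately have "a * z - \<epsilon> a \<cdot> z \<in> {x. \<epsilon> x = 0} \<inter> J" by blast
    then show ?thesis unfolding J(2) by simp
  qed
  then show ?thesis using z by (auto simp: left_integral_def normalized_def)
qed

text \<open>The product \<open>r * l\<close> equals \<open>l\<close> when \<open>r\<close> is moved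
  through the left integral, and equals \<open>r\<close> when \<open>l\<close> is moved through the
  right integral.\<close>

lemma left_right_integral_imp_haar:
  assumes "left_integral l" "normalized l" "right_integral r" "normalized r"
  shows "haar_integral l"
proof -
  have "r * l = l" using assms by (simp add: left_integral_def normalized_def)
  moreover have "r * l = r" using assms by (simp add: right_integral_def normalized_def)
  ultimately show ?thesis using assms by (simp add: haar_integral_def)
qed

section \<open>The counit applied to one leg of a tensor\<close>

definition counit_R :: "('k, 'i \<times> 'i) vec \<Rightarrow> 'a" where
  "counit_R = lift2 scale (\<lambda>x y. \<epsilon> y \<cdot> x)"

definition counit_L :: "('k, 'i \<times> 'i) vec \<Rightarrow> 'a" where
  "counit_L = lift2 scale (\<lambda>x y. \<epsilon> x \<cdot> y)"

lemma counit_RL_tens2: "counit_R (tens2 x y) = \<epsilon> y \<cdot> x" "counit_L (tens2 x y) = \<epsilon> x \<cdot> y"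
  unfolding counit_R_def counit_L_def by (rule lift2_tens2_bilin, intro linear_bialgebra_intros)+

lemma counit_RL_mult:
  "counit_R (t \<odot>\<^sub>2 u) = counit_R t * counit_R u" "counit_L (t \<odot>\<^sub>2 u) = counit_L t * counit_L u"
  unfolding counit_R_def counit_L_def
  by (rule lift2_mult_hom, intro linear_bialgebra_intros,
      simp add: counit_mult scale_mult_left scale_mult_right mult.commute)+

lemma counit_RL_comult: "counit_R (\<Delta> x) = x" "counit_L (\<Delta> x) = x"
  by (simp_all add: counit_R_def counit_L_def counit_left counit_right)

lemma counit_RL_push:
  "counit_R (lift2 (*s) F2 t2) = lift2 scale (\<lambda>x y. counit_R (F2 x y)) t2"
  "counit_R (lift3 (*s) F3 t3) = lift3 scale (\<lambda>x y z. counit_R (F3 x y z)) t3"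
  "counit_L (lift2 (*s) F2 t2) = lift2 scale (\<lambda>x y. counit_L (F2 x y)) t2"
  "counit_L (lift3 (*s) F3 t3) = lift3 scale (\<lambda>x y z. counit_L (F3 x y z)) t3"
  unfolding counit_R_def counit_L_def by (rule lift_push[OF vector_space_axioms])+

end

section \<open>Quasi-Hopf algebras\<close>

context quasi_hopf_algebra
begin

lemma antipode_inv [simp]: "S (inv S x) = x" "inv S (S x) = x"
  using bij_antipode by (simp_all add: bij_is_surj surj_f_inv_f bij_is_inj)

lemma linear_antipode_inv: "Vector_Spaces.linear scale scale (inv S)"
  using linear_antipode bij_antipode by (rule linear_inv)

lemma antipode_inv_mult: "inv S (x * y) = inv S y * inv S x"
  using antipode_inv(2)[of "inv S y * inv S x"] by (simp add: antipode_mult)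

lemma antipode_inv_one: "inv S 1 = 1"
  using antipode_inv(2)[of 1] by (simp add: antipode_one)

lemmas linear_hopf_intros = linear_bialgebra_intros
  linear_comp[OF linear_antipode] linear_comp[OF linear_antipode_inv]

text \<open>The \<alpha> axiom under a linear map \<open>G\<close> and in right-associated normal
  form, so that it can be applied inside longer products.\<close>

lemma lift2_antipode_alpha:
  assumes "lin G s"
  shows "lift2 s (\<lambda>x y. G (S x * (\<alpha> * y))) (\<Delta> a) = s (\<epsilon> a) (G \<alpha>)"
proof -
  interpret Vector_Spaces.linear scale s G by fact
  show ?thesis
    using lift2_apply[OF assms, of "\<lambda>x y. S x * \<alpha> * y" "\<Delta> a"]
    by (simp add: antipode_alpha[unfolded mult.assoc] scale mult.assoc)
qed

lemma lift2_antipode_beta: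
  assumes "lin G s"
  shows "lift2 s (\<lambda>x y. G (x * (\<beta> * S y))) (\<Delta> a) = s (\<epsilon> a) (G \<beta>)"
proof -
  interpret Vector_Spaces.linear scale s G by fact
  show ?thesis
    using lift2_apply[OF assms, of "\<lambda>x y. x * \<beta> * S y" "\<Delta> a"]
    by (simp add: antipode_beta[unfolded mult.assoc] scale mult.assoc)
qed

lemma lift3_antipode_reassociator:
  assumes "lin G s"
  shows "lift3 s (\<lambda>x y z. G (x * (\<beta> * (S y * (\<alpha> * z))))) \<phi> = G 1"
    and "lift3 s (\<lambda>x y z. G (S x * (\<alpha> * (y * (\<beta> * S z))))) \<psi> = G 1"
  using lift3_apply[OF assms, of "\<lambda>x y z. x * \<beta> * S y * \<alpha> * z" \<phi>]
    lift3_apply[OF assms, of "\<lambda>x y z. S x * \<alpha> * y * \<beta> * S z" \<psi>]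
  by (simp_all add: antipode_reassociator[unfolded mult.assoc]
      antipode_reassociator_inverse[unfolded mult.assoc] mult.assoc)

lemma tens2_antipode:
  "lift2 (*s) (\<lambda>y z. tens2 X (Y * (S y * (\<alpha> * (z * Z))))) (\<Delta> x) = \<epsilon> x *s tens2 X (Y * (\<alpha> * Z))"
  "lift2 (*s) (\<lambda>y z. tens2 (Y * (S y * (\<alpha> * (z * Z)))) X) (\<Delta> x) = \<epsilon> x *s tens2 (Y * (\<alpha> * Z)) X"
  "lift2 (*s) (\<lambda>y z. tens2 X (Y * (y * (\<beta> * (S z * Z))))) (\<Delta> x) = \<epsilon> x *s tens2 X (Y * (\<beta> * Z))"
  "lift2 (*s) (\<lambda>y z. tens2 (Y * (y * (\<beta> * (S z * Z)))) X) (\<Delta> x) = \<epsilon> x *s tens2 (Y * (\<beta> * Z)) X"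
proof -
  have "lin (\<lambda>w. tens2 X (Y * (w * Z))) (*s)" "lin (\<lambda>w. tens2 (Y * (w * Z)) X) (*s)"
    by (intro linear_hopf_intros)+
  from this[THEN lift2_antipode_alpha, of x] this[THEN lift2_antipode_beta, of x]
  show
    "lift2 (*s) (\<lambda>y z. tens2 X (Y * (S y * (\<alpha> * (z * Z))))) (\<Delta> x) = \<epsilon> x *s tens2 X (Y * (\<alpha> * Z))"
    "lift2 (*s) (\<lambda>y z. tens2 (Y * (S y * (\<alpha> * (z * Z)))) X) (\<Delta> x) = \<epsilon> x *s tens2 (Y * (\<alpha> * Z)) X"
    "lift2 (*s) (\<lambda>y z. tens2 X (Y * (y * (\<beta> * (S z * Z))))) (\<Delta> x) = \<epsilon> x *s tens2 X (Y * (\<beta> * Z))"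
    "lift2 (*s) (\<lambda>y z. tens2 (Y * (y * (\<beta> * (S z * Z)))) X) (\<Delta> x) = \<epsilon> x *s tens2 (Y * (\<beta> * Z)) X"
    by (simp_all only: mult.assoc)
qed

text \<open>Apply \<epsilon> to the \<alpha> axiom: the counit property leaves
  \<open>\<epsilon> (S a)\<close> on one side, and \<open>\<epsilon> \<alpha> = 1\<close> leaves
  \<open>\<epsilon> a\<close> on the other.\<close>

lemma counit_antipode: "\<epsilon> (S a) = \<epsilon> a"
proof -
  have "\<epsilon> (S a) = lift2 (*) (\<lambda>x y. \<epsilon> y * \<epsilon> (S x)) (\<Delta> a)"
    by (rule lift2_counit[symmetric]) (intro linear_hopf_intros)
  also have "\<dots> = \<epsilon> (\<epsilon> a \<cdot> \<alpha>)"
    using lift2_apply[OF linear_counit, of "\<lambda>x y. S x * \<alpha> * y" "\<Delta> a"]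
    by (simp add: antipode_alpha counit_mult counit_alpha mult.commute)
  finally show ?thesis
    using linear_counit by (simp add: Vector_Spaces.linear_iff counit_alpha)
qed

lemma counit_antipode_inv: "\<epsilon> (inv S a) = \<epsilon> a"
  using counit_antipode[of "inv S a"] by simp

section \<open>The elements \<open>p_R\<close> and \<open>q_L\<close> and their intertwining
  identities\<close>

definition q_L :: "('k, 'i \<times> 'i) vec" where
  "q_L = lift3 (*s) (\<lambda>x y z. tens2 (S x * (\<alpha> * y)) z) \<psi>"

lemma p_R_eq: "p_R = lift3 (*s) (\<lambda>x y z. tens2 x (y * (\<beta> * S z))) \<psi>"
  by (simp add: p_R_def mult.assoc)

text \<open>Quasi-coassociativity carries the coproducts of \<open>a\<close> across \<psi>; there
  two legs meet around \<beta> and collapse to a counit.\<close>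

lemma comult_p_R:
  "lift2 (*s) (\<lambda>x y. \<Delta> x \<odot>\<^sub>2 (p_R \<odot>\<^sub>2 tens2 1 (S y))) (\<Delta> a) = p_R \<odot>\<^sub>2 tens2 a 1"
proof -
  let ?F = "\<lambda>X Y Z. tens2 X (Y * (\<beta> * S Z))"
  have F: "trilin (*s) ?F" by (intro linear_hopf_intros)
  have c: "lift2 (*s) (\<lambda>x y. \<epsilon> y *s tens2 (X * x) Y) (\<Delta> a) = tens2 (X * a) Y" for X Y
    by (rule lift2_counit(2)) (intro linear_hopf_intros)
  have "lift2 (*s) (\<lambda>x y. \<Delta> x \<odot>\<^sub>2 (p_R \<odot>\<^sub>2 tens2 1 (S y))) (\<Delta> a) =
     lift3 (*s) (\<lambda>X Y Z. lift2 (*s) (\<lambda>x y. lift2 (*s) (\<lambda>x1 x2.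
         ?F (x1 * X) (x2 * Y) (y * Z)) (\<Delta> x)) (\<Delta> a)) \<psi>"
    by (simp only: p_R_eq mult2_push mult2_tens2)
      (simp only: mult2_tens2_lift mult.assoc mult_1_right
        antipode_mult lift2_lift3_commute[OF vec.vector_space_axioms])
  also have "\<dots> = lift3 (*s) (\<lambda>X Y Z. lift2 (*s) (\<lambda>x y. lift2 (*s) (\<lambda>y1 y2.
      ?F (X * x) (Y * y1) (Z * y2)) (\<Delta> y)) (\<Delta> a)) \<psi>"
    by (rule quasi_coassoc_inverse_lift[OF F, symmetric])
  also have "\<dots> = p_R \<odot>\<^sub>2 tens2 a 1"
    by (simp only: p_R_eq antipode_mult mult.assoc tens2_antipode c mult2_push mult2_tens2
        mult_1_right)
  finally show ?thesis .
qed

text \<open>The left-handed counterpart: after crossing \<psi>, two legs meet around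
  \<alpha>.\<close>

lemma q_L_comult:
  "lift2 (*s) (\<lambda>x y. tens2 (S x) 1 \<odot>\<^sub>2 (q_L \<odot>\<^sub>2 \<Delta> y)) (\<Delta> a) = tens2 1 a \<odot>\<^sub>2 q_L"
proof -
  let ?F = "\<lambda>X Y Z. tens2 (S X * (\<alpha> * Y)) Z"
  have F: "trilin (*s) ?F" by (intro linear_hopf_intros)
  have c: "lift2 (*s) (\<lambda>x y. \<epsilon> x *s tens2 X (y * Y)) (\<Delta> a) = tens2 X (a * Y)" for X Y
    by (rule lift2_counit(1)) (intro linear_hopf_intros)
  have "lift2 (*s) (\<lambda>x y. tens2 (S x) 1 \<odot>\<^sub>2 (q_L \<odot>\<^sub>2 \<Delta> y)) (\<Delta> a) =
     lift3 (*s) (\<lambda>X Y Z. lift2 (*s) (\<lambda>x y. lift2 (*s) (\<lambda>y1 y2.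
         ?F (X * x) (Y * y1) (Z * y2)) (\<Delta> y)) (\<Delta> a)) \<psi>"
    by (simp only: q_L_def mult2_push tens2_mult2_assoc)
      (simp only: mult2_tens2_lift mult.assoc mult_1_left antipode_mult
         lift2_lift3_commute[OF vec.vector_space_axioms])
  also have "\<dots> = lift3 (*s) (\<lambda>X Y Z. lift2 (*s) (\<lambda>x y. lift2 (*s) (\<lambda>x1 x2.
      ?F (x1 * X) (x2 * Y) (y * Z)) (\<Delta> x)) (\<Delta> a)) \<psi>"
    by (rule quasi_coassoc_inverse_lift[OF F])
  also have "\<dots> = tens2 1 a \<odot>\<^sub>2 q_L"
    by (simp only: q_L_def antipode_mult mult.assoc tens2_antipode c mult2_push mult2_tens2
        mult_1_left)
  finally show ?thesis .
qed

text \<open>With \<open>q1\<close> and \<open>q2\<close> the legs of \<open>q_R\<close>, the summand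
  is \<open>\<Delta> q1 \<odot>\<^sub>2 (p_R \<odot>\<^sub>2 tens2 1 (S q2))\<close>. After the
  pentagon, \<alpha> absorbs the coproduct at the left end and \<beta> the one at the right end; the
  first antipode normalization remains.\<close>

lemma comult_p_R_cancel:
  "lift3 (*s) (\<lambda>X Y Z. \<Delta> X \<odot>\<^sub>2 (p_R \<odot>\<^sub>2 tens2 1 (S Y * (\<alpha> * Z)))) \<phi> = tens2 1 1"
proof -
  let ?\<Phi> = "\<lambda>x y z w. tens2 x (y * (\<beta> * (S z * (\<alpha> * w))))"
  have \<Phi>: "quadlin (*s) ?\<Phi>" by (intro linear_hopf_intros)
  have a: "lift2 (*s) (\<lambda>a1 a2. ?\<Phi> x y (a1 * z) (a2 * w)) (\<Delta> a) = \<epsilon> a *s ?\<Phi> x y z w" for a x y z w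
    using tens2_antipode(1)[of x "y * (\<beta> * S z)"] by (simp only: antipode_mult mult.assoc)
  have b: "lift2 (*s) (\<lambda>a1 a2. ?\<Phi> x (y * a1) (z * a2) w) (\<Delta> a) = \<epsilon> a *s ?\<Phi> x y z w" for a x y z w
    by (simp only: antipode_mult mult.assoc tens2_antipode)
  have "lift3 (*s) (\<lambda>X Y Z. \<Delta> X \<odot>\<^sub>2 (p_R \<odot>\<^sub>2 tens2 1 (S Y * (\<alpha> * Z)))) \<phi> =
      lift4 (*s) ?\<Phi> (comult1 \<phi> \<odot>\<^sub>4 unit_right \<psi>)"
    by (simp only: lift4_slots(1)[OF \<Phi>] p_R_eq mult2_push mult2_tens2)
      (simp only: mult2_tens2_lift mult.assoc mult_1_right antipode_mult)
  also have "\<dots> = lift4 (*s) ?\<Phi> (unit_left \<phi>)"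
    unfolding pentagon_unit_right
    by (subst lift4_drop_left(3)[OF \<Phi> a], subst lift4_drop_right(2)[OF \<Phi> b], rule refl)
  also have "\<dots> = tens2 1 1"
    unfolding lift4_slots[OF \<Phi>] by (rule lift3_antipode_reassociator) (intro linear_hopf_intros)
  finally show ?thesis .
qed

text \<open>The same mechanism with the mirror form of the pentagon: \<alpha> absorbs
  \<open>comult2 \<phi>\<close>, \<beta> absorbs \<open>comult1 \<psi>\<close>, and
  \<open>unit_right \<phi>\<close> gives the normalization.\<close>

lemma q_L_comult_cancel:
  "lift3 (*s) (\<lambda>X Y Z. tens2 (X * (\<beta> * S Y)) 1 \<odot>\<^sub>2 (q_L \<odot>\<^sub>2 \<Delta> Z)) \<phi> = tens2 1 1"
proof -
  let ?\<Phi> = "\<lambda>x y z w. tens2 (x * (\<beta> * (S y * (\<alpha> * z)))) w"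
  have \<Phi>: "quadlin (*s) ?\<Phi>" by (intro linear_hopf_intros)
  have a: "lift2 (*s) (\<lambda>a1 a2. ?\<Phi> x (a1 * y) (a2 * z) w) (\<Delta> a) = \<epsilon> a *s ?\<Phi> x y z w" for a x y z w
    using tens2_antipode(2)[of "x * (\<beta> * S y)"] by (simp only: antipode_mult mult.assoc)
  have b: "lift2 (*s) (\<lambda>a1 a2. ?\<Phi> (x * a1) (y * a2) z w) (\<Delta> a) = \<epsilon> a *s ?\<Phi> x y z w" for a x y z w
    by (simp only: antipode_mult mult.assoc tens2_antipode)
  have "lift3 (*s) (\<lambda>X Y Z. tens2 (X * (\<beta> * S Y)) 1 \<odot>\<^sub>2 (q_L \<odot>\<^sub>2 \<Delta> Z)) \<phi> =
      lift4 (*s) ?\<Phi> (unit_left \<psi> \<odot>\<^sub>4 comult3 \<phi>)"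
    by (simp only: lift4_slots(2)[OF \<Phi>] q_L_def mult2_push tens2_mult2_assoc)
      (simp only: mult2_tens2_lift mult.assoc mult_1_left antipode_mult)
  also have "\<dots> = lift4 (*s) ?\<Phi> (unit_right \<phi>)"
    unfolding pentagon_unit_left mult4_assoc
    by (subst lift4_drop_left(2)[OF \<Phi> a], subst lift4_drop_right(1)[OF \<Phi> b], rule refl)
  also have "\<dots> = tens2 1 1"
    unfolding lift4_slots[OF \<Phi>] by (rule lift3_antipode_reassociator) (intro linear_hopf_intros)
  finally show ?thesis .
qed

section \<open>The antipode \<open>antipode2\<close> for \<Delta> with its elements \<gamma> and
  \<delta>\<close>

definition antipode2 :: "'a \<Rightarrow> ('k, 'i \<times> 'i) vec" where
  "antipode2 a = map2 S S (flip (\<Delta> a))"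

lemma antipode2_eq: "antipode2 a = lift2 (*s) (\<lambda>x y. tens2 (S y) (S x)) (\<Delta> a)"
proof -
  have "bilin (*s) (\<lambda>x y. tens2 (S x) (S y))" by (intro linear_hopf_intros)
  then show ?thesis
    by (simp add: antipode2_def map2_def flip_def lift_push[OF vec.vector_space_axioms]
        lift2_tens2_bilin)
qed

lemma linear_antipode2: "Vector_Spaces.linear scale (*s) antipode2"
  unfolding antipode2_eq[abs_def] by (intro linear_hopf_intros)

lemma antipode2_mult: "antipode2 (x * y) = antipode2 y \<odot>\<^sub>2 antipode2 x"
proof -
  have "bilin (*s) (\<lambda>x y. tens2 (S y) (S x))" by (intro linear_hopf_intros)
  note m = lift2_comult_mult[OF this]
  show ?thesis
    unfolding antipode2_eq m
    by (subst lift2_lift2_commute[OF vec.vector_space_axioms])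
      (simp only: mult2_push(1), simp only: mult2_push(3) mult2_tens2 antipode_mult)
qed

lemmas linear_twist_intros = linear_hopf_intros linear_comp[OF linear_antipode2]

text \<open>Grouping the four legs so that \<open>q_L\<close> appears makes the intertwining
  identity of \<open>q_L\<close> available for \<gamma>.\<close>

lemma gamma_eq:
  "gamma = lift3 (*s) (\<lambda>x y z. tens2 (S y) (S x * \<alpha>) \<odot>\<^sub>2 (q_L \<odot>\<^sub>2 \<Delta> z)) \<phi>"
proof -
  have "quadlin (*s) (\<lambda>t u v w. tens2 (S u * \<alpha> * v) (S t * \<alpha> * w))"
    by (intro linear_hopf_intros)
  note slots = lift4_slots(2)[OF this]
  have "gamma = lift4 (*s) (\<lambda>t u v w. tens2 (S u * \<alpha> * v) (S t * \<alpha> * w))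
      (unit_left \<psi> \<odot>\<^sub>4 comult3 \<phi>)"
    by (simp add: gamma_def slot_defs)
  also have "\<dots> = lift3 (*s) (\<lambda>x y z. tens2 (S y) (S x * \<alpha>) \<odot>\<^sub>2 (q_L \<odot>\<^sub>2 \<Delta> z)) \<phi>"
    by (simp only: slots q_L_def mult2_push tens2_mult2_assoc)
      (simp only: mult2_tens2_lift mult.assoc antipode_mult)
  finally show ?thesis .
qed

text \<open>Drinfeld's element \<delta>, the coevaluation counterpart of \<open>gamma\<close>,
  expressed through \<open>p_R\<close> just as \<open>gamma_eq\<close> expresses
  \<open>gamma\<close> through \<open>q_L\<close>.\<close>

definition delta :: "('k, 'i \<times> 'i) vec" where
  "delta = lift3 (*s) (\<lambda>x y z. \<Delta> x \<odot>\<^sub>2 (p_R \<odot>\<^sub>2 tens2 (\<beta> * S z) (S y))) \<phi>"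

lemma q_L_comult_assoc:
  "lift2 (*s) (\<lambda>x y. tens2 (S x) 1 \<odot>\<^sub>2 (q_L \<odot>\<^sub>2 (\<Delta> y \<odot>\<^sub>2 t))) (\<Delta> a) = tens2 1 a \<odot>\<^sub>2 (q_L \<odot>\<^sub>2 t)"
  using arg_cong[OF q_L_comult[of a], of "\<lambda>u. u \<odot>\<^sub>2 t"] by (simp only: mult2_push mult2_assoc)

lemma comult_p_R_assoc:
  "lift2 (*s) (\<lambda>x y. t \<odot>\<^sub>2 (\<Delta> x \<odot>\<^sub>2 (p_R \<odot>\<^sub>2 (tens2 1 (S y) \<odot>\<^sub>2 u)))) (\<Delta> a) =
    t \<odot>\<^sub>2 (p_R \<odot>\<^sub>2 (tens2 a 1 \<odot>\<^sub>2 u))"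
  using arg_cong[OF comult_p_R[of a], of "\<lambda>v. t \<odot>\<^sub>2 (v \<odot>\<^sub>2 u)"]
  by (simp only: mult2_push mult2_assoc)

lemma antipode_q_L_comult:
  "lift2 (*s) (\<lambda>x y. tens2 (v * S x) w \<odot>\<^sub>2 (q_L \<odot>\<^sub>2 (\<Delta> y \<odot>\<^sub>2 t))) (\<Delta> a) =
    tens2 v (w * a) \<odot>\<^sub>2 (q_L \<odot>\<^sub>2 t)"
  using arg_cong[OF q_L_comult_assoc[of t a], of "\<lambda>u. tens2 v w \<odot>\<^sub>2 u"]
  by (simp only: mult2_push tens2_mult2_assoc mult_1_right)

lemma comult_p_R_antipode:
  "lift2 (*s) (\<lambda>x y. t \<odot>\<^sub>2 (\<Delta> x \<odot>\<^sub>2 (p_R \<odot>\<^sub>2 tens2 v (S y * w)))) (\<Delta> a) =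
    t \<odot>\<^sub>2 (p_R \<odot>\<^sub>2 tens2 (a * v) w)"
  using comult_p_R_assoc[of t "tens2 v w" a] by (simp only: mult2_tens2 mult_1_left)

text \<open>After quasi-coassociativity, \<open>q_L\<close> replaces one coproduct by a factor in
  the second leg, where it meets \<alpha>. Thus \<open>gamma\<close> plays the role of \<alpha> for
  \<open>antipode2\<close>.\<close>

lemma gamma_invariant:
  "lift2 (*s) (\<lambda>x y. antipode2 x \<odot>\<^sub>2 (gamma \<odot>\<^sub>2 \<Delta> y)) (\<Delta> a) = \<epsilon> a *s gamma"
proof -
  note vs = vec.vector_space_axioms
  let ?F = "\<lambda>x y z. tens2 (S y) (S x * \<alpha>) \<odot>\<^sub>2 (q_L \<odot>\<^sub>2 \<Delta> z)"
  have F: "trilin (*s) ?F" by (intro linear_twist_intros)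
  have c: "lift2 (*s) (\<lambda>x y. tens2 X (Y * (S x * (\<alpha> * y)))) (\<Delta> a) = \<epsilon> a *s tens2 X (Y * \<alpha>)" for X Y
    using tens2_antipode(1)[of X Y 1 a] by (simp only: mult_1_right)
  have "lift2 (*s) (\<lambda>x y. antipode2 x \<odot>\<^sub>2 (gamma \<odot>\<^sub>2 \<Delta> y)) (\<Delta> a) =
      lift3 (*s) (\<lambda>X Y Z. lift2 (*s) (\<lambda>x y. lift2 (*s) (\<lambda>x1 x2.
          ?F (X * x1) (Y * x2) (Z * y)) (\<Delta> x)) (\<Delta> a)) \<phi>"
    by (simp only: gamma_eq antipode2_eq mult2_push mult2_assoc tens2_mult2_assoc)
      (simp only: antipode_mult comult_mult mult.assoc lift2_lift3_commute[OF vs])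
  also have "\<dots> = lift3 (*s) (\<lambda>X Y Z. lift2 (*s) (\<lambda>x y. lift2 (*s) (\<lambda>y1 y2.
      ?F (x * X) (y1 * Y) (y2 * Z)) (\<Delta> y)) (\<Delta> a)) \<phi>"
    by (rule quasi_coassoc_lift[OF F, symmetric])
  also have "\<dots> = lift3 (*s) (\<lambda>X Y Z. \<epsilon> a *s ?F X Y Z) \<phi>"
    by (simp only: antipode_mult comult_mult antipode_q_L_comult mult.assoc
        mult2_push(1)[symmetric] c mult2_scale)
  finally show ?thesis by (simp only: lift_scale[OF vs] gamma_eq)
qed

text \<open>Mirror of the argument for \<open>gamma\<close>: \<open>p_R\<close> produces a factor in
  the first leg, where \<beta> absorbs it, so \<open>delta\<close> plays the role of
  \<beta>.\<close>

lemma delta_invariant: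
  "lift2 (*s) (\<lambda>x y. \<Delta> x \<odot>\<^sub>2 (delta \<odot>\<^sub>2 antipode2 y)) (\<Delta> a) = \<epsilon> a *s delta"
proof -
  note vs = vec.vector_space_axioms
  let ?F = "\<lambda>x y z. \<Delta> x \<odot>\<^sub>2 (p_R \<odot>\<^sub>2 tens2 (\<beta> * S z) (S y))"
  have F: "trilin (*s) ?F" by (intro linear_twist_intros)
  have c: "lift2 (*s) (\<lambda>x y. tens2 (x * (\<beta> * (S y * Y))) X) (\<Delta> a) = \<epsilon> a *s tens2 (\<beta> * Y) X" for X Y
    using tens2_antipode(4)[of 1 Y X a] by (simp only: mult_1_left)
  have "lift2 (*s) (\<lambda>x y. \<Delta> x \<odot>\<^sub>2 (delta \<odot>\<^sub>2 antipode2 y)) (\<Delta> a) =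
      lift3 (*s) (\<lambda>X Y Z. lift2 (*s) (\<lambda>x y. lift2 (*s) (\<lambda>y1 y2.
          ?F (x * X) (y1 * Y) (y2 * Z)) (\<Delta> y)) (\<Delta> a)) \<phi>"
    by (simp only: delta_def antipode2_eq mult2_push mult2_assoc mult2_tens2)
      (simp only: antipode_mult comult_mult mult.assoc mult2_assoc lift2_lift3_commute[OF vs])
  also have "\<dots> = lift3 (*s) (\<lambda>X Y Z. lift2 (*s) (\<lambda>x y. lift2 (*s) (\<lambda>x1 x2.
      ?F (X * x1) (Y * x2) (Z * y)) (\<Delta> x)) (\<Delta> a)) \<phi>"
    by (rule quasi_coassoc_lift[OF F])
  also have "\<dots> = lift3 (*s) (\<lambda>X Y Z. \<epsilon> a *s ?F X Y Z) \<phi>"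
    by (simp only: antipode_mult comult_mult mult2_assoc comult_p_R_antipode mult.assoc)
      (simp only: mult2_push(3)[symmetric] c mult2_scale)
  finally show ?thesis by (simp only: lift_scale[OF vs] delta_def)
qed

text \<open>This is the first antipode normalization for \<open>antipode2\<close>,
  \<open>gamma\<close> and \<open>delta\<close>. The pentagon trades three copies of \<phi> for two,
  and the result splits into the two unit identities for \<open>p_R\<close> and
  \<open>q_L\<close>.\<close>

lemma delta_gamma_cancel:
  "lift3 (*s) (\<lambda>X Y Z. \<Delta> X \<odot>\<^sub>2 (delta \<odot>\<^sub>2 (antipode2 Y \<odot>\<^sub>2 (gamma \<odot>\<^sub>2 \<Delta> Z)))) \<phi> = tens2 1 1"
proof -
  note vs = vec.vector_space_axioms
  let ?\<Phi> = "\<lambda>x y z w. \<Delta> x \<odot>\<^sub>2 (p_R \<odot>\<^sub>2 (tens2 (\<beta> * S z) (S y * \<alpha>) \<odot>\<^sub>2 (q_L \<odot>\<^sub>2 \<Delta> w)))"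
  have \<Phi>: "quadlin (*s) ?\<Phi>" by (intro linear_twist_intros)
  have "lift3 (*s) (\<lambda>X Y Z. \<Delta> X \<odot>\<^sub>2 (delta \<odot>\<^sub>2 (antipode2 Y \<odot>\<^sub>2 (gamma \<odot>\<^sub>2 \<Delta> Z)))) \<phi> =
      lift3 (*s) (\<lambda>X Y Z. lift3 (*s) (\<lambda>x y z. lift3 (*s) (\<lambda>x' y' z'. lift2 (*s) (\<lambda>Y1 Y2.
        ?\<Phi> (X * x') (x * Y1 * y') (y * Y2 * z') (z * Z)) (\<Delta> Y)) \<phi>) \<phi>) \<phi>"
    by (simp only: gamma_eq mult2_push, simp only: antipode2_eq mult2_push,
        simp only: delta_def mult2_push lift2_lift3_commute[OF vs])
      (simp only: mult2_assoc tens2_mult2_assoc antipode_mult comult_mult mult.assoc)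
  also have "\<dots> = lift4 (*s) ?\<Phi> (unit_left \<phi> \<odot>\<^sub>4 comult2 \<phi> \<odot>\<^sub>4 unit_right \<phi>)"
    unfolding lift4_slots(4)[OF \<Phi>] by (rule lift3_lift3_commute[OF vs])
  also have "\<dots> = lift4 (*s) ?\<Phi> (comult3 \<phi> \<odot>\<^sub>4 comult1 \<phi>)"
    by (simp only: pentagon_slots)
  \<comment> \<open>The coproduct of \<open>Z\<close> is absorbed by \<open>q_L\<close> and that of
    \<open>x\<close> by \<open>p_R\<close>. Each leg of the middle tensor then involves a single
    copy of \<phi>, so the two sums can be separated.\<close>
  also have "\<dots> = lift3 (*s) (\<lambda>X Y Z. lift3 (*s) (\<lambda>x y z.
      \<Delta> X \<odot>\<^sub>2 (p_R \<odot>\<^sub>2 (tens2 (x * (\<beta> * S y)) (S Y * (\<alpha> * Z)) \<odot>\<^sub>2 (q_L \<odot>\<^sub>2 \<Delta> z)))) \<phi>) \<phi>"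
  proof -
    have 1: "lift2 (*s) (\<lambda>Z1 Z2. ?\<Phi> (X * x1) (Y * x2) (Z1 * y) (Z2 * z)) (\<Delta> Z) =
      \<Delta> X \<odot>\<^sub>2 (\<Delta> x1 \<odot>\<^sub>2 (p_R \<odot>\<^sub>2 (tens2 1 (S x2) \<odot>\<^sub>2 (tens2 (\<beta> * S y) (S Y * (\<alpha> * Z)) \<odot>\<^sub>2 (q_L \<odot>\<^sub>2 \<Delta>
          z)))))"
      for X Y Z x1 x2 y z
      using antipode_q_L_comult[of "\<beta> * S y" "S x2 * (S Y * \<alpha>)" "\<Delta> z" Z]
      by (simp only: comult_mult antipode_mult mult.assoc mult2_assoc mult2_push(3)[symmetric]
          tens2_mult2_assoc mult_1_left)
    show ?thesis
      by (simp only: lift4_slots(3)[OF \<Phi>] 1, simp only: comult_p_R_assoc)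
        (simp only: tens2_mult2_assoc mult_1_left)
  qed
  also have "\<dots> = lift3 (*s) (\<lambda>X Y Z. \<Delta> X \<odot>\<^sub>2 (p_R \<odot>\<^sub>2 tens2 1 (S Y * (\<alpha> * Z)))) \<phi> \<odot>\<^sub>2
      lift3 (*s) (\<lambda>x y z. tens2 (x * (\<beta> * S y)) 1 \<odot>\<^sub>2 (q_L \<odot>\<^sub>2 \<Delta> z)) \<phi>"
    by (simp only: mult2_push(2)) (simp only: mult2_push(4) mult2_assoc tens2_mult2_assoc
        mult_1_left mult_1_right)
  finally show ?thesis by (simp only: comult_p_R_cancel q_L_comult_cancel mult2_one)
qed

section \<open>Invertibility of Drinfeld's element\<close>

definition drinfeld_inv :: "('k, 'i \<times> 'i) vec" where
  "drinfeld_inv = lift3 (*s) (\<lambda>x y z. \<Delta> (S x * (\<alpha> * y)) \<odot>\<^sub>2 (delta \<odot>\<^sub>2 antipode2 z)) \<psi>"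

text \<open>\<open>drinfeld_inv\<close> is built like \<open>drinfeld\<close> with the two antipodes
  exchanged. The \<alpha> axiom creates coproducts of \<open>a\<close>, quasi-coassociativity
  carries them across \<psi>, and \<open>delta\<close> absorbs them.\<close>

lemma drinfeld_inv_antipode2: "drinfeld_inv \<odot>\<^sub>2 antipode2 a = \<Delta> (S a) \<odot>\<^sub>2 drinfeld_inv"
proof -
  note vs = vec.vector_space_axioms
  let ?F = "\<lambda>x y z. \<Delta> (S x * (\<alpha> * y)) \<odot>\<^sub>2 (delta \<odot>\<^sub>2 antipode2 z)"
  have F: "trilin (*s) ?F" by (intro linear_twist_intros)
  have alpha: "lift2 (*s) (\<lambda>x1 x2. ?F (x1 * X) (x2 * Y) Z) (\<Delta> x) = \<epsilon> x *s ?F X Y Z" for X Y Z x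
  proof -
    have "lin (\<lambda>v. \<Delta> (S X * (v * Y)) \<odot>\<^sub>2 (delta \<odot>\<^sub>2 antipode2 Z)) (*s)"
      by (intro linear_twist_intros)
    from lift2_antipode_alpha[OF this] show ?thesis
      by (simp only: antipode_mult mult.assoc)
  qed
  have beta: "lift2 (*s) (\<lambda>y1 y2. ?F X (Y * y1) (Z * y2)) (\<Delta> y) = \<epsilon> y *s ?F X Y Z" for X Y Z y
    using arg_cong[OF delta_invariant[of y], of "\<lambda>u. \<Delta> (S X * (\<alpha> * Y)) \<odot>\<^sub>2 (u \<odot>\<^sub>2 antipode2 Z)"]
    by (simp only: mult2_push mult2_scale mult2_assoc antipode2_mult comult_mult mult.assoc)
  have c: "lift2 (*s) (\<lambda>x y. \<epsilon> x *s ?F X Y (y * Z)) (\<Delta> a) = ?F X Y (a * Z)"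
    "lift2 (*s) (\<lambda>x y. \<epsilon> y *s ?F (X * x) Y Z) (\<Delta> a) = ?F (X * a) Y Z" for X Y Z
    by (rule lift2_counit, intro linear_twist_intros)+
  have "drinfeld_inv \<odot>\<^sub>2 antipode2 a = lift3 (*s) (\<lambda>X Y Z. ?F X Y (a * Z)) \<psi>"
    by (simp only: drinfeld_inv_def mult2_push mult2_assoc antipode2_mult)
  also have "\<dots> = lift3 (*s) (\<lambda>X Y Z. lift2 (*s) (\<lambda>x y. lift2 (*s) (\<lambda>x1 x2.
      ?F (x1 * X) (x2 * Y) (y * Z)) (\<Delta> x)) (\<Delta> a)) \<psi>"
    by (simp only: alpha c)
  also have "\<dots> = lift3 (*s) (\<lambda>X Y Z. lift2 (*s) (\<lambda>x y. lift2 (*s) (\<lambda>y1 y2.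
      ?F (X * x) (Y * y1) (Z * y2)) (\<Delta> y)) (\<Delta> a)) \<psi>"
    by (rule quasi_coassoc_inverse_lift[OF F, symmetric])
  also have "\<dots> = lift3 (*s) (\<lambda>X Y Z. ?F (X * a) Y Z) \<psi>"
    by (simp only: beta c)
  also have "\<dots> = \<Delta> (S a) \<odot>\<^sub>2 drinfeld_inv"
    by (simp only: drinfeld_inv_def mult2_push mult2_assoc antipode_mult comult_mult)
  finally show ?thesis .
qed

text \<open>The \<alpha> axiom permits inserting \<open>comult1 \<phi>\<close>, which completes a
  side of the pentagon. On the other side \<open>gamma\<close> and \<open>delta\<close> absorb the
  outer factors, leaving \<open>\<Delta> \<alpha>\<close> times the sum in
  \<open>delta_gamma_cancel\<close>.\<close>

lemma drinfeld_inv_gamma: "drinfeld_inv \<odot>\<^sub>2 gamma = \<Delta> \<alpha>"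
proof -
  let ?\<Phi> = "\<lambda>x y z w. \<Delta> (S x * (\<alpha> * y)) \<odot>\<^sub>2 (delta \<odot>\<^sub>2 (antipode2 z \<odot>\<^sub>2 (gamma \<odot>\<^sub>2 \<Delta> w)))"
  have \<Phi>: "quadlin (*s) ?\<Phi>" by (intro linear_twist_intros)
  have a: "lift2 (*s) (\<lambda>a1 a2. ?\<Phi> (a1 * x) (a2 * y) z w) (\<Delta> a) = \<epsilon> a *s ?\<Phi> x y z w" for a x y z w
  proof -
    have "lin (\<lambda>v. \<Delta> (S x * (v * y)) \<odot>\<^sub>2 (delta \<odot>\<^sub>2 (antipode2 z \<odot>\<^sub>2 (gamma \<odot>\<^sub>2 \<Delta> w)))) (*s)"
      by (intro linear_twist_intros)
    from lift2_antipode_alpha[OF this] show ?thesis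
      by (simp only: antipode_mult mult.assoc)
  qed
  have b: "lift2 (*s) (\<lambda>a1 a2. ?\<Phi> x (y * a1) (z * a2) w) (\<Delta> a) = \<epsilon> a *s ?\<Phi> x y z w" for a x y z w
    using arg_cong[OF delta_invariant[of a], of "\<lambda>u. \<Delta> (S x * (\<alpha> * y)) \<odot>\<^sub>2 (u \<odot>\<^sub>2
      (antipode2 z \<odot>\<^sub>2 (gamma \<odot>\<^sub>2 \<Delta> w)))"]
    by (simp only: mult2_push mult2_scale mult2_assoc antipode2_mult comult_mult mult.assoc)
  have c: "lift2 (*s) (\<lambda>a1 a2. ?\<Phi> x y (a1 * z) (a2 * w)) (\<Delta> a) = \<epsilon> a *s ?\<Phi> x y z w" for a x y z w
    using arg_cong[OF gamma_invariant[of a], of "\<lambda>u. \<Delta> (S x * (\<alpha> * y)) \<odot>\<^sub>2 (delta \<odot>\<^sub>2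
      (antipode2 z \<odot>\<^sub>2 (u \<odot>\<^sub>2 \<Delta> w)))"]
    by (simp only: mult2_push mult2_scale mult2_assoc antipode2_mult comult_mult mult.assoc)
  have "drinfeld_inv \<odot>\<^sub>2 gamma = lift4 (*s) ?\<Phi> (unit_right \<psi>)"
    by (simp only: lift4_slots(6)[OF \<Phi>] comult_one mult2_one drinfeld_inv_def mult2_push
        mult2_assoc)
  also have "\<dots> = lift4 (*s) ?\<Phi> (comult1 \<phi> \<odot>\<^sub>4 unit_right \<psi>)"
    by (rule lift4_drop_left(1)[OF \<Phi> a, symmetric])
  also have "\<dots> = lift4 (*s) ?\<Phi> (unit_left \<phi>)"
    unfolding pentagon_unit_right
    by (subst lift4_drop_left(3)[OF \<Phi> c], subst lift4_drop_right(2)[OF \<Phi> b], rule refl)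
  also have "\<dots> = \<Delta> \<alpha>"
    using arg_cong[OF delta_gamma_cancel, of "\<lambda>u. \<Delta> \<alpha> \<odot>\<^sub>2 u"]
    unfolding lift4_slots(5)[OF \<Phi>]
    by (simp only: antipode_one mult_1_left comult_mult mult2_assoc mult2_push mult2_one)
  finally show ?thesis .
qed

text \<open>Moving \<open>drinfeld_inv\<close> past \<open>antipode2\<close> and turning
  \<open>gamma\<close> into \<open>\<Delta> \<alpha>\<close> leaves \<Delta> of the second antipode
  normalization. A left inverse is enough by finite dimension.\<close>

lemma drinfeld_invertible: "is_inverse2 drinfeld drinfeld_inv"
proof (rule is_inverse2_if_left_inverse)
  have "drinfeld_inv \<odot>\<^sub>2 drinfeld = lift3 (*s) (\<lambda>x y z.
      drinfeld_inv \<odot>\<^sub>2 antipode2 x \<odot>\<^sub>2 (gamma \<odot>\<^sub>2 \<Delta> (y * (\<beta> * S z)))) \<psi>"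
    by (simp only: drinfeld_def mult2_push mult2_assoc antipode2_def[symmetric] mult.assoc)
  also have "\<dots> = lift3 (*s) (\<lambda>x y z. \<Delta> (S x * (\<alpha> * (y * (\<beta> * S z))))) \<psi>"
    unfolding drinfeld_inv_antipode2 mult2_assoc
    unfolding mult2_assoc[symmetric, of drinfeld_inv gamma] drinfeld_inv_gamma
    by (simp only: comult_mult)
  also have "\<dots> = tens2 1 1"
    using lift3_antipode_reassociator(2)[OF linear_comult] by (simp only: comult_one)
  finally show "drinfeld_inv \<odot>\<^sub>2 drinfeld = tens2 1 1" .
qed

section \<open>Counit values of Drinfeld's element and of \<open>Delta_bar\<close>\<close>

lemma counit_R_map2_flip:
  assumes "Vector_Spaces.linear scale scale g" "\<And>x. \<epsilon> (g x) = \<epsilon> x"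
  shows "counit_R (map2 g g (flip t)) = g (counit_L t)"
proof -
  have b: "bilin (*s) (\<lambda>x y. tens2 (g x) (g y))"
    using assms(1) by (intro linear_hopf_intros linear_comp[OF assms(1)])
  have "counit_R (map2 g g (flip t)) = lift2 scale (\<lambda>x y. \<epsilon> x \<cdot> g y) t"
    by (simp add: map2_def flip_def lift_push[OF vec.vector_space_axioms] lift2_tens2_bilin[OF b]
        counit_RL_push counit_RL_tens2 assms(2))
  also have "\<dots> = g (counit_L t)"
    using lift2_apply[OF assms(1)] assms(1)
    by (simp add: counit_L_def Vector_Spaces.linear_iff)
  finally show ?thesis .
qed

lemma counit_RL_antipode2: "counit_R (antipode2 a) = S a" "counit_L (antipode2 a) = S a"
  by (simp_all only: antipode2_eq counit_RL_push counit_RL_tens2 counit_antipode)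
    (rule lift2_counit, intro linear_hopf_intros)+

lemma counit_RL_q_L: "counit_R q_L = \<alpha>" "counit_L q_L = 1"
proof -
  have "counit_R q_L = lift3 scale (\<lambda>x y z. \<epsilon> z \<cdot> (S x * (\<alpha> * y))) \<psi>"
    by (simp only: q_L_def counit_RL_push counit_RL_tens2)
  also have "\<dots> = S 1 * (\<alpha> * 1)" by (rule lift3_counit) (intro linear_hopf_intros)
  finally show "counit_R q_L = \<alpha>" by (simp add: antipode_one)
  have "counit_L q_L = lift3 scale (\<lambda>x y z. \<epsilon> x \<cdot> (\<epsilon> y \<cdot> z)) \<psi>"
    by (simp add: q_L_def counit_RL_push counit_RL_tens2 counit_mult counit_antipode counit_alpha)
  also have "\<dots> = \<epsilon> 1 \<cdot> 1" by (rule lift3_counit) (intro linear_hopf_intros)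
  finally show "counit_L q_L = 1" by (simp add: counit_one)
qed

lemma counit_RL_gamma: "counit_R gamma = \<alpha>" "counit_L gamma = \<alpha>"
proof -
  have "counit_R gamma = lift3 scale (\<lambda>x y z. \<epsilon> x \<cdot> (S y * (\<alpha> * z))) \<phi>"
    by (simp add: gamma_eq counit_RL_push counit_RL_mult counit_RL_tens2 counit_RL_comult
        counit_RL_q_L counit_mult counit_antipode counit_alpha scale_mult_left)
  also have "\<dots> = S 1 * (\<alpha> * 1)" by (rule lift3_counit) (intro linear_hopf_intros)
  finally show "counit_R gamma = \<alpha>" by (simp add: antipode_one)
  have "counit_L gamma = lift3 scale (\<lambda>x y z. \<epsilon> y \<cdot> (S x * \<alpha> * z)) \<phi>"
    by (simp add: gamma_eq counit_RL_push counit_RL_mult counit_RL_tens2 counit_RL_comult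
        counit_RL_q_L counit_antipode scale_mult_left)
  also have "\<dots> = S 1 * \<alpha> * 1" by (rule lift3_counit) (intro linear_hopf_intros)
  finally show "counit_L gamma = \<alpha>" by (simp add: antipode_one)
qed

text \<open>Both partial counits are multiplicative; they send \<open>antipode2\<close> to
  \<open>S\<close>, \<open>gamma\<close> to \<alpha> and undo \<Delta>. What remains is the second
  antipode normalization.\<close>

lemma counit_RL_drinfeld: "counit_R drinfeld = 1" "counit_L drinfeld = 1"
  unfolding drinfeld_def antipode2_def[symmetric]
  by (simp_all only: counit_RL_push counit_RL_mult counit_RL_antipode2 counit_RL_gamma
      counit_RL_comult mult.assoc[symmetric] antipode_reassociator_inverse)

lemma counit_L_p_R: "counit_L p_R = \<beta>"
proof -
  have "counit_L p_R = lift3 scale (\<lambda>x y z. \<epsilon> x \<cdot> (y * (\<beta> * S z))) \<psi>"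
    by (simp only: p_R_eq counit_RL_push counit_RL_tens2)
  also have "\<dots> = 1 * (\<beta> * S 1)" by (rule lift3_counit) (intro linear_hopf_intros)
  finally show ?thesis by (simp add: antipode_one)
qed

lemma counit_L_q_R: "counit_L q_R = inv S \<alpha>"
proof -
  have "counit_L q_R = lift3 scale (\<lambda>x y z. \<epsilon> x \<cdot> (inv S (\<alpha> * z) * y)) \<phi>"
    by (simp only: q_R_def counit_RL_push counit_RL_tens2)
  also have "\<dots> = inv S (\<alpha> * 1) * 1" by (rule lift3_counit) (intro linear_hopf_intros)
  finally show ?thesis by simp
qed

text \<open>The factor \<open>inv S \<beta>\<close> comes from \<open>p_R\<close> in
  \<open>V_elem\<close>, and \<alpha> from \<open>q_R\<close> in \<open>U_elem\<close>; Drinfeld's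
  element and its inverse contribute 1. Invertibility is what determines the definite description in
  \<open>inverse2 drinfeld\<close>.\<close>

lemma counit_R_Delta_bar: "counit_R (Delta_bar a) = inv S \<beta> * a * \<alpha>"
proof -
  have "counit_R (drinfeld \<odot>\<^sub>2 inverse2 drinfeld) = 1"
    using drinfeld_invertible inverse2_eqI[OF drinfeld_invertible]
    by (simp add: is_inverse2_def counit_RL_tens2 counit_one)
  then have "counit_R (inverse2 drinfeld) = 1" by (simp add: counit_RL_mult counit_RL_drinfeld)
  then show ?thesis
    by (simp add: Delta_bar_def V_elem_def U_elem_def h_elem_def counit_RL_mult counit_RL_comult
        counit_R_map2_flip[OF linear_antipode counit_antipode]
        counit_R_map2_flip[OF linear_antipode_inv counit_antipode_inv]
        counit_L_p_R counit_L_q_R counit_RL_drinfeld antipode_inv_one)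
qed

section \<open>Trace formulas for \<open>lambda_e\<close>\<close>

lemma lambda_e_eq:
  "lambda_e a = (\<Sum>i\<in>UNIV. dual_basis i (a * (S (S (b i)) * S \<beta> * \<alpha>)))"
proof -
  \<comment> \<open>Cyclicity of the trace will carry the factors to the left of \<open>a\<close>
    around to the right of \<open>q2\<close>, which produces \<open>w\<close>. Its sum over
    \<open>q_R\<close> is \<open>inv S\<close> of the first antipode normalization, hence 1.\<close>
  define w where "w q1 q2 = q2 * (inv S \<beta> * inv S q1)" for q1 q2
  have w: "lift2 scale w q_R = 1"
  proof -
    have "bilin scale w" unfolding w_def by (intro linear_hopf_intros)
    then have "lift2 scale w q_R = lift3 scale (\<lambda>x y z. inv S (x * (\<beta> * (S y * (\<alpha> * z))))) \<phi>"
      by (simp add: q_R_def lift_push[OF vector_space_axioms] lift2_tens2_bilin)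
        (simp add: w_def antipode_inv_mult mult.assoc)
    also have "\<dots> = 1"
      using lift3_antipode_reassociator(1)[OF linear_antipode_inv] by (simp add: antipode_inv_one)
    finally show ?thesis .
  qed
  have 1: "lift2 (*) (\<lambda>x y. dual_basis i x * \<epsilon> y) t = dual_basis i (counit_R t)" for i t
    using lift2_apply[OF linear_dual_basis, of i "\<lambda>x y. \<epsilon> y \<cdot> x" t] linear_dual_basis[of i]
    by (simp add: counit_R_def Vector_Spaces.linear_iff mult.commute)
  have "lambda_e a = (\<Sum>i\<in>UNIV. lift2 (*) (\<lambda>q1 q2.
      dual_basis i (inv S \<beta> * (inv S q1 * (a * S (S (q2 * b i)) * S \<beta> * \<alpha>)))) q_R)"
    by (simp add: lambda_e_def coint_proj_def 1 counit_RL_push counit_R_Delta_bar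
        lift2_apply[OF linear_dual_basis] mult.assoc)
  also have "\<dots> = lift2 (*) (\<lambda>q1 q2. \<Sum>i\<in>UNIV.
      dual_basis i ((\<lambda>x. inv S \<beta> * (inv S q1 * x)) (a * S (S (q2 * b i)) * S \<beta> * \<alpha>))) q_R"
    unfolding lift2_sum by (subst sum.swap) (simp add: sum_distrib_left)
  also have "\<dots> = lift2 (*) (\<lambda>q1 q2. \<Sum>i\<in>UNIV.
      dual_basis i (a * S (S (w q1 q2 * b i)) * S \<beta> * \<alpha>)) q_R"
  proof -
    have "(\<Sum>i\<in>UNIV. dual_basis i ((\<lambda>x.
        inv S \<beta> * (inv S q1 * x)) (a * S (S (q2 * b i)) * S \<beta> * \<alpha>))) =
        (\<Sum>i\<in>UNIV. dual_basis i (a * S (S (w q1 q2 * b i)) * S \<beta> * \<alpha>))" for q1 q2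
      by (subst trace_commute[of "\<lambda>x. inv S \<beta> * (inv S q1 * x)"
          "\<lambda>x. a * S (S (q2 * x)) * S \<beta> * \<alpha>"], (intro linear_hopf_intros)+)
        (simp add: w_def mult.assoc)
    then show ?thesis by simp
  qed
  \<comment> \<open>The trace depends linearly on the factor \<open>w q1 q2\<close>, so the sum over
    \<open>q_R\<close> can be taken inside.\<close>
  also have "\<dots> = (\<Sum>i\<in>UNIV. dual_basis i (a * S (S (lift2 scale w q_R * b i)) * S \<beta> * \<alpha>))"
    by (rule lift2_apply[symmetric]) (intro linear_hopf_intros linear_sum)
  finally show ?thesis by (simp add: w mult.assoc)
qed

text \<open>Traces are invariant under conjugation, here by \<open>S\<close> and then by its square.
  The resulting form is the counit of the integral that is built from \<open>splitting\<close>
  below.\<close>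

lemma lambda_e_eq_antipode:
  "lambda_e a = (\<Sum>i\<in>UNIV. dual_basis i (S (S (\<beta> * b i) * \<alpha>) * S a))"
proof -
  let ?T = "\<lambda>x. S (S (\<beta> * x) * \<alpha>) * S a" and ?T' = "\<lambda>x. a * (S (S x) * S \<beta> * \<alpha>)"
  have lin: "Vector_Spaces.linear scale scale ?T" "Vector_Spaces.linear scale scale ?T'"
    "Vector_Spaces.linear scale scale (\<lambda>x. S (S x))"
    "Vector_Spaces.linear scale scale (\<lambda>x. inv S (inv S x))"
    by (intro linear_hopf_intros)+
  have "(\<Sum>i\<in>UNIV. dual_basis i (?T (b i))) = (\<Sum>i\<in>UNIV. dual_basis i (S (?T (inv S (b i)))))"
    by (rule trace_conjugate[symmetric]) (simp_all add: lin linear_antipode linear_antipode_inv)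
  also have "\<dots> = (\<Sum>i\<in>UNIV. dual_basis i (S (S (?T' (inv S (inv S (b i)))))))"
    by (simp add: antipode_mult mult.assoc)
  also have "\<dots> = (\<Sum>i\<in>UNIV. dual_basis i (?T' (b i)))"
    by (rule trace_conjugate) (simp_all add: lin)
  finally show ?thesis by (simp add: lambda_e_eq)
qed

text \<open>The integral absorbs everything to its right, so the trace becomes that of the map
  sending \<open>x\<close> to \<open>\<epsilon> x \<cdot> e\<close>.\<close>

lemma lambda_e_right_integral:
  assumes "right_integral e"
  shows "lambda_e e = \<epsilon> e"
proof -
  have "\<epsilon> (S \<beta>) = 1" by (simp add: counit_antipode counit_beta)
  then have "e * (S (S (b i)) * S \<beta> * \<alpha>) = \<epsilon> (b i) \<cdot> e" for i
    using assms by (simp add: right_integral_def counit_mult counit_antipode counit_alpha)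
  moreover have "dual_basis i (c \<cdot> x) = c * dual_basis i x" for i c x
    using linear_dual_basis[of i] by (simp add: Vector_Spaces.linear_iff)
  ultimately show ?thesis
    using linear_sum_dual_basis[OF linear_counit, of e] by (simp add: lambda_e_eq mult.commute)
qed

section \<open>Exchange of left and right integrals by the antipode\<close>

lemma left_right_integral_antipode:
  "left_integral l \<Longrightarrow> right_integral (S l)" "right_integral r \<Longrightarrow> left_integral (inv S r)"
proof -
  have S: "S (c \<cdot> x) = c \<cdot> S x" "inv S (c \<cdot> x) = c \<cdot> inv S x" for c x
    using linear_antipode linear_antipode_inv by (simp_all add: Vector_Spaces.linear_iff)
  assume l: "left_integral l"
  show "right_integral (S l)"
    unfolding right_integral_def
  proof
    fix a
    have "S l * S (inv S a) = S (inv S a * l)" by (simp only: antipode_mult)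
    also have "\<dots> = \<epsilon> a \<cdot> S l" using l by (simp add: left_integral_def S counit_antipode_inv)
    finally show "S l * a = \<epsilon> a \<cdot> S l" by simp
  qed
next
  have S: "S (c \<cdot> x) = c \<cdot> S x" "inv S (c \<cdot> x) = c \<cdot> inv S x" for c x
    using linear_antipode linear_antipode_inv by (simp_all add: Vector_Spaces.linear_iff)
  assume r: "right_integral r"
  show "left_integral (inv S r)"
    unfolding left_integral_def
  proof
    fix a
    have "inv S (S a) * inv S r = inv S (r * S a)" by (simp only: antipode_inv_mult)
    also have "\<dots> = \<epsilon> a \<cdot> inv S r" using r by (simp add: right_integral_def S counit_antipode)
    finally show "a * inv S r = \<epsilon> a \<cdot> inv S r" by simp
  qed
qed

section \<open>The splitting map, separability and integrals from traces\<close>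

definition splitting :: "'a \<Rightarrow> ('k, 'i \<times> 'i) vec" where
  "splitting h = lift3 (*s) (\<lambda>X Y Z.
     lift2 (*s) (\<lambda>h1 h2. tens2 (X * h1) (S (Y * h2) * (\<alpha> * Z))) (\<Delta> h)) \<phi>"

lemma linear_splitting: "Vector_Spaces.linear scale (*s) splitting"
  unfolding splitting_def[abs_def] by (intro linear_hopf_intros)

text \<open>\<open>h \<otimes> v \<mapsto> splitting h \<cdot> (1 \<otimes> v)\<close> intertwines the diagonal action of \<open>H\<close> with the action on
  the first factor alone; it splits the projection of a free module onto \<open>H \<otimes> V\<close>.\<close>

lemma splitting_comult:
  "tens2 a 1 \<odot>\<^sub>2 splitting h = lift2 (*s) (\<lambda>x y. splitting (x * h) \<odot>\<^sub>2 tens2 1 y) (\<Delta> a)"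
proof -
  note vs = vec.vector_space_axioms
  let ?F = "\<lambda>X Y Z. lift2 (*s) (\<lambda>h1 h2. tens2 (X * h1) (S (Y * h2) * (\<alpha> * Z))) (\<Delta> h)"
  have F: "trilin (*s) ?F" by (intro linear_hopf_intros)
  have "bilin (*s) (\<lambda>h1 h2. tens2 (X * h1) (S (Y * h2) * (\<alpha> * Z)))" for X Y Z
    by (intro linear_hopf_intros)
  note m = lift2_comult_mult[OF this]
  have "lift2 (*s) (\<lambda>x y. splitting (x * h) \<odot>\<^sub>2 tens2 1 y) (\<Delta> a) =
      lift3 (*s) (\<lambda>X Y Z. lift2 (*s) (\<lambda>x y. lift2 (*s) (\<lambda>x1 x2.
          ?F (X * x1) (Y * x2) (Z * y)) (\<Delta> x)) (\<Delta> a)) \<phi>"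
    by (simp only: splitting_def m mult2_push mult2_tens2)
      (simp only: mult.assoc mult_1_right lift2_lift3_commute[OF vs])
  also have "\<dots> = lift3 (*s) (\<lambda>X Y Z. lift2 (*s) (\<lambda>x y. lift2 (*s) (\<lambda>y1 y2.
      ?F (x * X) (y1 * Y) (y2 * Z)) (\<Delta> y)) (\<Delta> a)) \<phi>"
    by (rule quasi_coassoc_lift[OF F, symmetric])
  \<comment> \<open>In the second leg \<open>y1\<close> and \<open>y2\<close> meet around
    \<alpha>.\<close>
  also have "\<dots> = lift3 (*s) (\<lambda>X Y Z. lift2 (*s) (\<lambda>x y. \<epsilon> y *s ?F (x * X) Y Z) (\<Delta> a)) \<phi>"
  proof -
    have "lift2 (*s) (\<lambda>y1 y2. ?F X (y1 * Y) (y2 * Z)) (\<Delta> y) = \<epsilon> y *s ?F X Y Z" for X Y Z y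
      using tens2_antipode(1)[of _ "S _ * S Y" Z y, unfolded mult.assoc]
      by (subst lift2_lift2_commute[OF vs]) (simp only: antipode_mult mult.assoc lift_scale[OF vs])
    then show ?thesis by simp
  qed
  also have "\<dots> = lift3 (*s) (\<lambda>X Y Z. ?F (a * X) Y Z) \<phi>"
  proof -
    have "lift2 (*s) (\<lambda>x y. \<epsilon> y *s ?F (x * X) Y Z) (\<Delta> a) = ?F (a * X) Y Z" for X Y Z
      by (rule lift2_counit) (intro linear_hopf_intros)
    then show ?thesis by simp
  qed
  finally show ?thesis
    by (simp only: splitting_def mult2_push mult2_tens2 mult.assoc mult_1_left)
qed

text \<open>At an integral, every \<open>splitting (x * l)\<close> is a multiple of a single tensor,
  so \<open>splitting_comult\<close> becomes the intertwining condition for a separability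
  idempotent.\<close>

lemma left_integral_imp_separable:
  assumes l: "left_integral l" "normalized l"
  shows "separable_algebra"
proof -
  \<comment> \<open>Placed at the right of the first leg, \<beta> stands between the two legs and
    interferes with neither outer action.\<close>
  define E where "E = lift2 (*s) (\<lambda>u v. tens2 (u * \<beta>) v) (splitting l)"
  have splitting_l: "splitting (x * l) = \<epsilon> x *s splitting l" for x
    using l(1) linear_splitting by (simp add: left_integral_def Vector_Spaces.linear_iff)
  have b: "bilin (*s) (\<lambda>u v. tens2 (u * \<beta>) v)"
    "bilin (*s) (\<lambda>u v. lift2 (*s) (\<lambda>u' v'. tens2 (u * u' * \<beta>) (v * v')) t)"
    "bilin (*s) (\<lambda>u' v'. tens2 (u * u' * \<beta>) (v * v'))" for u v t
    by (intro linear_hopf_intros)+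
  have E: "tens2 c 1 \<odot>\<^sub>2 E = E \<odot>\<^sub>2 tens2 1 c" for c
  proof -
    have "tens2 c 1 \<odot>\<^sub>2 E = lift2 (*s) (\<lambda>u v. tens2 (u * \<beta>) v) (tens2 c 1 \<odot>\<^sub>2 splitting l)"
      unfolding lift2_mult2[OF b(1)] lift2_tens2_bilin[OF b(2)]
      by (simp only: E_def mult2_push mult2_tens2 mult_1_left mult.assoc)
    also have "tens2 c 1 \<odot>\<^sub>2 splitting l = lift2 (*s) (\<lambda>x y.
        \<epsilon> x *s (splitting l \<odot>\<^sub>2 tens2 1 y)) (\<Delta> c)"
      by (simp only: splitting_comult splitting_l mult2_scale)
    also have "\<dots> = splitting l \<odot>\<^sub>2 tens2 1 c"
      by (rule lift2_counit) (intro linear_hopf_intros)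
    also have "lift2 (*s) (\<lambda>u v. tens2 (u * \<beta>) v) (splitting l \<odot>\<^sub>2 tens2 1 c) = E \<odot>\<^sub>2 tens2 1 c"
      unfolding lift2_mult2[OF b(1)] lift2_tens2_bilin[OF b(3)]
      by (simp only: E_def mult2_push mult2_tens2 mult_1_right)
    finally show ?thesis .
  qed
  have E_mult: "lift2 scale (*) E = 1"
  proof -
    have b: "bilin scale (*)" "bilin scale (\<lambda>u v. u * \<beta> * v)" by (intro linear_hopf_intros)+
    \<comment> \<open>Normalization enters here: the \<beta> axiom yields the factor
      \<open>\<epsilon> l\<close>, which is 1.\<close>
    have beta: "lift2 scale (\<lambda>x y. X * (x * (\<beta> * (S y * Y)))) (\<Delta> l) = X * (\<beta> * Y)" for X Y
    proof -
      have "lin (\<lambda>w. X * (w * Y)) scale" by (intro linear_hopf_intros)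
      from lift2_antipode_beta[OF this, of l] show ?thesis
        using l(2) by (simp add: normalized_def mult.assoc)
    qed
    have "lift2 scale (*) E = lift3 scale (\<lambda>x y z. x * (\<beta> * (S y * (\<alpha> * z)))) \<phi>"
      unfolding E_def splitting_def lift_push[OF vector_space_axioms] lift2_tens2_bilin[OF b(1)]
          lift2_tens2_bilin[OF b(2)]
      by (simp only: antipode_mult mult.assoc beta)
    also have "\<dots> = 1"
      by (rule lift3_antipode_reassociator) (intro linear_hopf_intros)
    finally show ?thesis .
  qed
  have mult_x: "lift2 scale (*) (tens2 x 1 \<odot>\<^sub>2 t) = x * lift2 scale (*) t" for x t
  proof -
    have b: "bilin scale (*)" "bilin scale (\<lambda>u v. lift2 scale (\<lambda>u' v'. u * u' * (v * v')) t)"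
      by (intro linear_hopf_intros)+
    have "lin (\<lambda>y. x * y) scale" by (intro linear_hopf_intros)
    from lift2_apply[OF this, of "(*)" t] show ?thesis
      unfolding lift2_mult2[OF b(1)] lift2_tens2_bilin[OF b(2)] by (simp add: mult.assoc)
  qed
  show ?thesis
    unfolding separable_algebra_def
  proof (intro exI[of _ "\<lambda>x. tens2 x 1 \<odot>\<^sub>2 E"] conjI allI)
    show "Vector_Spaces.linear scale (*s) (\<lambda>x. tens2 x 1 \<odot>\<^sub>2 E)" by (intro linear_hopf_intros)
    show "tens2 (a * x * c) 1 \<odot>\<^sub>2 E = tens2 a 1 \<odot>\<^sub>2 (tens2 x 1 \<odot>\<^sub>2 E) \<odot>\<^sub>2 tens2 1 c" for a x c
      by (simp only: mult2_assoc E[symmetric] tens2_mult2_assoc mult_1_left mult.assoc)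
    show "lift2 scale (*) (tens2 x 1 \<odot>\<^sub>2 E) = x" for x by (simp add: mult_x E_mult)
  qed
qed

text \<open>The canonical element of H \<otimes> H*, twisted by \<beta>, is sent through
  \<open>splitting\<close>, and the second leg is contracted with the dual basis. The \<beta> axiom
  makes the result an integral; its counit is the trace in
  \<open>lambda_e_eq_antipode\<close>.\<close>

lemma ex_left_integral_counit_eq_lambda_e: "\<exists>l. left_integral l \<and> \<epsilon> l = lambda_e a"
proof -
  let ?K = "\<lambda>i u v. dual_basis i (S v * S a) \<cdot> u"
  define l where "l = (\<Sum>i\<in>UNIV. lift2 scale (?K i) (splitting (\<beta> * b i)))"
  have "left_integral l"
    unfolding left_integral_def
  proof
    fix x
    have K: "x * lift2 scale (?K i) t = lift2 scale (?K i) (tens2 x 1 \<odot>\<^sub>2 t)" for i t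
    proof -
      have b: "bilin scale (?K i)" "bilin scale (\<lambda>u v. lift2 scale (\<lambda>u' v'.
          ?K i (u * u') (v * v')) t)"
        by (intro linear_hopf_intros)+
      have "lin (\<lambda>y. x * y) scale" by (intro linear_hopf_intros)
      from lift2_apply[OF this, of "?K i" t] show ?thesis
        unfolding lift2_mult2[OF b(1)] lift2_tens2_bilin[OF b(2)] by (simp add: scale_mult_right)
    qed
    \<comment> \<open>Since \<open>S\<close> reverses products, right multiplication by
      \<open>y\<close> in the second leg becomes left multiplication by \<open>S y\<close> under the
      functional: the action on H*.\<close>
    have K': "lift2 scale (?K i) (t \<odot>\<^sub>2 tens2 1 y) =
        lift2 scale (\<lambda>u v. dual_basis i (S y * (S v * S a)) \<cdot> u) t" for i y t
    proof -
      have b: "bilin scale (?K i)" "bilin scale (\<lambda>u' v'. ?K i (u * u') (v * v'))" for u v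
        by (intro linear_hopf_intros)+
      show ?thesis
        unfolding lift2_mult2[OF b(1)] lift2_tens2_bilin[OF b(2)] by
            (simp add: antipode_mult mult.assoc)
    qed
    have "x * l = (\<Sum>i\<in>UNIV. lift2 scale (\<lambda>x1 x2. lift2 scale
        (\<lambda>u v. dual_basis i (S x2 * (S v * S a)) \<cdot> u) (splitting (x1 * (\<beta> * b i)))) (\<Delta> x))"
      by (simp only: l_def sum_distrib_left K splitting_comult lift_push[OF vector_space_axioms] K')
    also have "\<dots> = lift2 scale (\<lambda>x1 x2. \<Sum>i\<in>UNIV. lift2 scale
        (\<lambda>u v. dual_basis i (S x2 * (S v * S a)) \<cdot> u) (splitting (x1 * (\<beta> * b i)))) (\<Delta> x)"
      unfolding lift2_sum[of _ _ "\<Delta> x"] scale_sum_right by (rule sum.swap)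
    \<comment> \<open>Invariance of the canonical element moves \<open>S x2\<close> from the
      functional to the basis vector, so that it lands to the right of \<beta> opposite
      \<open>x1\<close>.\<close>
    also have "\<dots> = lift2 scale (\<lambda>x1 x2. \<Sum>i\<in>UNIV. lift2 scale (?K i)
        (splitting (x1 * (\<beta> * (S x2 * b i))))) (\<Delta> x)"
    proof -
      have "(\<Sum>i\<in>UNIV. lift2 scale (\<lambda>u v.
          dual_basis i (S x2 * (S v * S a)) \<cdot> u) (splitting (x1 * (\<beta> * b i)))) =
        (\<Sum>i\<in>UNIV. lift2 scale (?K i) (splitting (x1 * (\<beta> * (S x2 * b i)))))" for x1 x2
        by (rule sum_dual_basis_move[where H = "\<lambda>y. splitting (x1 * (\<beta> * y))" and w = "\<lambda>y.
            S x2 * y"])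
          (intro linear_hopf_intros linear_comp[OF linear_splitting])+
      then show ?thesis by simp
    qed
    also have "\<dots> = \<epsilon> x \<cdot> l"
    proof -
      have "lin (\<lambda>w. \<Sum>i\<in>UNIV. lift2 scale (?K i) (splitting (w * b i))) scale"
        by (intro linear_hopf_intros linear_sum linear_comp[OF linear_splitting])
      from lift2_antipode_beta[OF this, of x] show ?thesis by (simp add: l_def mult.assoc)
    qed
    finally show "x * l = \<epsilon> x \<cdot> l" .
  qed
  moreover have "\<epsilon> l = lambda_e a"
  proof -
    \<comment> \<open>The counit on the first leg removes both the coproduct of \<open>h\<close> and
      the first slot of \<phi>, leaving \<open>S h * \<alpha>\<close> in the second leg.\<close>
    have *: "lift2 (*) (\<lambda>u v. \<epsilon> u * g v) (splitting h) = g (S h * \<alpha>)" if g: "lin g (*)" for g h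
    proof -
      note fs = vector_space_over_itself.vector_space_axioms
      have b: "bilin (*) (\<lambda>u v. \<epsilon> u * g v)"
        by (intro linear_hopf_intros linear_comp[OF g])
      have "lift2 (*) (\<lambda>u v. \<epsilon> u * g v) (splitting h) =
          lift3 (*) (\<lambda>X Y Z. \<epsilon> X * lift2 (*) (\<lambda>h1 h2. \<epsilon> h1 * g (S (Y * h2) * (\<alpha> * Z))) (\<Delta> h)) \<phi>"
        by (simp only: splitting_def lift_push[OF fs] lift2_tens2_bilin[OF b] counit_mult
            mult.assoc lift_scale[OF fs])
      also have "\<dots> = lift3 (*) (\<lambda>X Y Z. \<epsilon> X * g (S (Y * h) * (\<alpha> * Z))) \<phi>"
      proof -
        have "lift2 (*) (\<lambda>h1 h2. \<epsilon> h1 * g (S (Y * h2) * (\<alpha> * Z))) (\<Delta> h) =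
            g (S (Y * h) * (\<alpha> * Z))" for Y Z
          by (rule lift2_counit) (intro linear_hopf_intros linear_comp[OF g])
        then show ?thesis by simp
      qed
      also have "\<dots> = g (S (1 * h) * (\<alpha> * 1))"
        by (rule lift3_counit) (intro linear_hopf_intros linear_comp[OF g])
      finally show ?thesis by simp
    qed
    have "\<epsilon> l = (\<Sum>i\<in>UNIV. lift2 (*) (\<lambda>u v. \<epsilon> u * dual_basis i (S v * S a)) (splitting (\<beta> * b i)))"
    proof -
      interpret Vector_Spaces.linear scale "(*)" \<epsilon> by (fact linear_counit)
      show ?thesis
        by (simp add: l_def sum lift2_apply[OF linear_counit] scale mult.commute)
    qed
    also have "\<dots> = (\<Sum>i\<in>UNIV. dual_basis i (S (S (\<beta> * b i) * \<alpha>) * S a))"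
    proof -
      have "lin (\<lambda>v. dual_basis i (S v * S a)) (*)" for i by (intro linear_hopf_intros)
      from *[OF this] show ?thesis by simp
    qed
    finally show ?thesis by (simp only: lambda_e_eq_antipode)
  qed
  ultimately show ?thesis by blast
qed

end

theorem theorem5p7:
  fixes scale :: "'k::field \<Rightarrow> 'a::ring_1 \<Rightarrow> 'a"
    and b :: "'i::finite \<Rightarrow> 'a"
    and \<Delta> :: "'a \<Rightarrow> ('k, 'i \<times> 'i) vec"
    and \<epsilon> :: "'a \<Rightarrow> 'k"
    and \<phi> :: "('k, 'i \<times> 'i \<times> 'i) vec"
    and S :: "'a \<Rightarrow> 'a"
    and \<alpha> \<beta> :: 'a
  assumes "quasi_hopf_algebra scale b \<Delta> \<epsilon> \<phi> S \<alpha> \<beta>"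
  shows
    "quasi_hopf_algebra.lambda_e scale b \<Delta> \<epsilon> \<phi> S \<alpha> \<beta> =
       (\<lambda>a. \<Sum>i\<in>UNIV. (S (S (b i)) * S \<beta> * \<alpha> \<rightharpoonup> fin_dim_algebra.dual_basis scale b i) a) \<and>
     quasi_hopf_algebra.lambda_e scale b \<Delta> \<epsilon> \<phi> S \<alpha> \<beta>
       \<in> quasi_hopf_algebra.left_cointegrals scale b \<Delta> \<phi> S \<alpha> \<beta> \<and>
     (semisimple_ring TYPE('a) \<longleftrightarrow>
       (\<exists>l. quasi_bialgebra.left_integral scale \<epsilon> l \<and> quasi_bialgebra.normalized \<epsilon> l)) \<and>
     (semisimple_ring TYPE('a) \<longleftrightarrow>
       (\<exists>r. quasi_bialgebra.right_integral scale \<epsilon> r \<and> quasi_bialgebra.normalized \<epsilon> r)) \<and>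
     (semisimple_ring TYPE('a) \<longleftrightarrow>
       quasi_hopf_algebra.lambda_e scale b \<Delta> \<epsilon> \<phi> S \<alpha> \<beta> \<noteq> (\<lambda>a. 0)) \<and>
     (semisimple_ring TYPE('a) \<longleftrightarrow> (\<exists>e. quasi_bialgebra.haar_integral scale \<epsilon> e)) \<and>
     (semisimple_ring TYPE('a) \<longleftrightarrow> fin_dim_algebra.separable_algebra scale b) \<and>
     (\<forall>e. quasi_bialgebra.haar_integral scale \<epsilon> e \<longrightarrow>
       quasi_hopf_algebra.lambda_e scale b \<Delta> \<epsilon> \<phi> S \<alpha> \<beta> e = 1)"
proof -
  interpret quasi_hopf_algebra scale b \<Delta> \<epsilon> \<phi> S \<alpha> \<beta> by fact
  let ?L = "\<exists>l. left_integral l \<and> normalized l"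
  have formula: "lambda_e = (\<lambda>a. \<Sum>i\<in>UNIV. (S (S (b i)) * S \<beta> * \<alpha> \<rightharpoonup> dual_basis i) a)"
    by (rule ext) (simp add: lambda_e_eq hit_def)
  have mem: "lambda_e \<in> left_cointegrals"
    using linear_counit by (auto simp: left_cointegrals_def lambda_e_def)
  \<comment> \<open>The implications form a cycle: semisimplicity gives a left integral, this gives
    separability, and separability gives semisimplicity.\<close>
  have semisimple: "semisimple_ring TYPE('a) \<longleftrightarrow> ?L"
    and separable: "semisimple_ring TYPE('a) \<longleftrightarrow> separable_algebra"
    using semisimple_imp_left_integral left_integral_imp_separable separable_imp_semisimple by
        blast+
  \<comment> \<open>The antipode and its inverse exchange the two kinds of integrals and preserve
    \<epsilon>, hence normalization.\<close>
  have right: "(\<exists>r. right_integral r \<and> normalized r) \<longleftrightarrow> ?L"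
    using left_right_integral_antipode
    by (metis counit_antipode counit_antipode_inv normalized_def)
  have haar: "(\<exists>e. haar_integral e) \<longleftrightarrow> ?L"
    using right left_right_integral_imp_haar by (metis haar_integral_def)
  have lambda_haar: "lambda_e e = 1" if "haar_integral e" for e
    using that lambda_e_right_integral by (simp add: haar_integral_def normalized_def)
  \<comment> \<open>The left integral whose counit is the nonzero value \<open>lambda_e a\<close> is
    rescaled to counit 1.\<close>
  have "?L" if "lambda_e a \<noteq> 0" for a
  proof -
    obtain l where l: "left_integral l" "\<epsilon> l = lambda_e a"
      using ex_left_integral_counit_eq_lambda_e by blast
    have "left_integral (scale (inverse (\<epsilon> l)) l)"
      using l(1) by (simp add: left_integral_def scale_mult_right mult.commute)
    moreover have "normalized (scale (inverse (\<epsilon> l)) l)"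
      using that l(2) by (simp add: normalized_def counit_scale)
    ultimately show ?thesis by blast
  qed
  \<comment> \<open>For the converse, a left integral yields a Haar integral, at which
    \<open>lambda_e\<close> takes the value 1.\<close>
  then have "lambda_e \<noteq> (\<lambda>a. 0) \<longleftrightarrow> ?L"
    using lambda_haar haar by (metis zero_neq_one)
  then show ?thesis
    using formula mem semisimple separable right haar lambda_haar by simp
qed

end
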